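(* Let $d$ be a positive integer and $0<p<1$. There exists a constant $\delta_p$ such that $$\lim_{n\to\infty}\frac{1}{n}\mathbb{E}[L(\mathcal{G}(K^{(d)}_n,p))]=\sup_{n\in\mathbb{N}}\frac{1}{n}\mathbb{E}[L(\mathcal{G}(K^{(d)}_n,p))]=\delta_p,$$ and $\delta_p/p^{1/d}\to c_d$ as $p\to 0$.
   Context: $K^{(d)}_n$ is the complete $d$-partite hyper-graph with color classes $d$ disjoint copies of $[n]$ (natural order) and edge set $[n]^d$. $\mathcal{G}(K^{(d)}_n,p)$ is the distribution of the random hyper-subgraph in which each edge of $K^{(d)}_n$ is present independently with probability $p$. Edges are partially ordered componentwise: $(v_1,\dots,v_d)\preceq(v_1',\dots,v_d')$ iff $v_i\le v_i'$ for all $i$. A non-crossing hyper-matching is a set of pairwise vertex-disjoint edges any two of which are comparable under $\preceq$; $L(G)$ is the maximum size of one in $G$, and $L(\mathcal{F})$ is the random variable $L(G)$ with $G\sim\mathcal{F}$. The constant $c_d$ (the Bollobás–Winkler / $d$-dimensional Ulam constant) is defined by $c_d=\lim_{m\to\infty}H_d(m)/m^{1/d}$, where $H_d(m)$ is the length of the longest chain (in the componentwise order) among $m$ points chosen independently and uniformly from $[0,1]^d$. *)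

theory Defs
  imports "HOL-Probability.Probability"
begin

text \<open>Points of \<open>[0,1]^d\<close> and edges of the \<open>d\<close>-partite hypergraph are both functions
  that matter only on the coordinates \<open>i < d\<close> (extensional outside).\<close>

definition comp_le :: "nat \<Rightarrow> (nat \<Rightarrow> 'a::linorder) \<Rightarrow> (nat \<Rightarrow> 'a) \<Rightarrow> bool" where
  "comp_le d x y \<longleftrightarrow> (\<forall>i<d. x i \<le> y i)"

definition comp_chain :: "nat \<Rightarrow> (nat \<Rightarrow> 'a::linorder) set \<Rightarrow> bool" where
  "comp_chain d C \<longleftrightarrow> (\<forall>x\<in>C. \<forall>y\<in>C. comp_le d x y \<or> comp_le d y x)"

definition complete_edges :: "nat \<Rightarrow> nat \<Rightarrow> (nat \<Rightarrow> nat) set" where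
  "complete_edges d n = (\<Pi>\<^sub>E i\<in>{..<d}. {1..n})"

text \<open>The vertex \<open>v\<close> of the \<open>i\<close>-th colour class is the pair \<open>(i, v)\<close>, which keeps the
  \<open>d\<close> copies of \<open>[n]\<close> disjoint.\<close>

definition edge_verts :: "nat \<Rightarrow> (nat \<Rightarrow> nat) \<Rightarrow> (nat \<times> nat) set" where
  "edge_verts d e = {(i, e i) | i. i < d}"

definition noncrossing_matching :: "nat \<Rightarrow> (nat \<Rightarrow> nat) set \<Rightarrow> bool" where
  "noncrossing_matching d M \<longleftrightarrow>
     pairwise (\<lambda>e f. disjnt (edge_verts d e) (edge_verts d f)) M \<and> comp_chain d M"

definition max_noncrossing :: "nat \<Rightarrow> (nat \<Rightarrow> nat) set \<Rightarrow> nat" where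
  "max_noncrossing d G = Max (card ` {M. M \<subseteq> G \<and> noncrossing_matching d M})"

definition random_hypergraph :: "nat \<Rightarrow> nat \<Rightarrow> real \<Rightarrow> (nat \<Rightarrow> nat) set pmf" where
  "random_hypergraph d n p =
     map_pmf (\<lambda>b. {e \<in> complete_edges d n. b e})
       (Pi_pmf (complete_edges d n) False (\<lambda>_. bernoulli_pmf p))"

definition expected_L :: "nat \<Rightarrow> real \<Rightarrow> nat \<Rightarrow> real" where
  "expected_L d p n =
     measure_pmf.expectation (random_hypergraph d n p) (\<lambda>G. real (max_noncrossing d G))"

definition longest_chain :: "nat \<Rightarrow> (nat \<Rightarrow> real) set \<Rightarrow> nat" where
  "longest_chain d S = Max (card ` {C. C \<subseteq> S \<and> comp_chain d C})"

definition unif_cube :: "nat \<Rightarrow> (nat \<Rightarrow> real) measure" where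
  "unif_cube d = (\<Pi>\<^sub>M i\<in>{..<d}. uniform_measure lborel {0..1})"

definition unif_points :: "nat \<Rightarrow> nat \<Rightarrow> (nat \<Rightarrow> nat \<Rightarrow> real) measure" where
  "unif_points d m = (\<Pi>\<^sub>M j\<in>{..<m}. unif_cube d)"

text \<open>The limit of the random variables \<open>H\<^sub>d(m) / m\<^bsup>1/d\<^esup>\<close> is taken in
  probability, as in the theorem of Bollobas and Winkler.\<close>

definition ulam_const :: "nat \<Rightarrow> real" where
  "ulam_const d = (THE c. \<forall>\<epsilon>>0.
     (\<lambda>m. measure (unif_points d m)
        {\<omega> \<in> space (unif_points d m).
           \<bar>real (longest_chain d (\<omega> ` {..<m})) / real m powr (1 / real d) - c\<bar> > \<epsilon>})
     \<longlonglongrightarrow> 0)"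

end

theory Submission
  imports Defs "HOL-Real_Asymp.Real_Asymp"
begin

text \<open>
  Placing the random hypergraph on \<open>[a]^d\<close> below-left of an independent one on \<open>[b]^d\<close> makes
  \<open>E L\<close> superadditive, so \<open>E L / n\<close> converges to its supremum \<open>\<delta>\<^sub>p\<close>; the same decomposition makes
  the Laplace transform of \<open>L\<close> submultiplicative, which gives an exponential lower tail.

  Reparametrise by \<open>p = 1 - exp (- x)\<close>, the probability that a cell receiving a Poisson number of
  points of mean \<open>x\<close> is occupied. Merging blocks of \<open>k^d\<close> cells turns the parameter \<open>x / k^d\<close> into \<open>x\<close>
  and can only decrease \<open>L\<close>. Together with monotonicity in \<open>p\<close> and the first moment bound
  \<open>E L \<le> 2 e n p^(1/d)\<close> this shows that \<open>\<delta>\<^sub>p / p^(1/d)\<close> converges to the supremum \<open>c\<close> of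
  \<open>E L / (n x^(1/d))\<close> over all \<open>x\<close> and \<open>n\<close>.

  To identify \<open>c\<close> with the Ulam constant, throw \<open>m\<close> uniform points into the grid of \<open>n^d\<close> cells. The
  cells occupied by a Poisson number of points form exactly the random hypergraph, and Poisson tails
  remove the randomness of the number of points. A coarse grid bounds the longest chain from below with
  high probability by nearly \<open>c m^(1/d)\<close>; an infinitely fine grid bounds its mean from above by nearly
  \<open>c m^(1/d)\<close>. These two bounds already force convergence in probability.
\<close>

subsection \<open>Strict chains\<close>

text \<open>\<open>ulam_const\<close> is a \<open>THE\<close> term, so nothing is known about it
  before convergence in probability and uniqueness of the limit are proved: the Bollobas-Winkler
  limit is derived here, not assumed. The two comparisons with a grid are asymmetric. Cells that
  increase strictly in every coordinate come from points that do, so any grid bounds the longest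
  chain from below. Conversely, comparable points may share a cell coordinate, which is unlikely
  only if \<open>n\<close> is large for fixed \<open>m\<close>; hence the upper bound is for the
  mean, with \<open>n\<close> sent to infinity before \<open>m\<close>. In the parameter
  \<open>x\<close>, an empty cell has probability \<open>exp (- x)\<close>, so intensities add when
  cells are merged and \<open>x\<close> behaves like a volume; this is what makes both block merging
  and Poisson occupancy exact identities in law. Such identities are proved without following single
  edges: the law of a random subset \<open>S\<close> of a finite set is determined by the
  probabilities of \<open>S \<subseteq> T\<close>, and these are explicit powers in every model
  used. Passing between \<open>m\<close> points and a Poisson number of them rests on monotonicity
  in the number of points. The first moment bound is there to keep the suprema finite.\<close>

definition strict_chain :: "nat \<Rightarrow> (nat \<Rightarrow> 'a::linorder) set \<Rightarrow> bool" where
  "strict_chain d M \<longleftrightarrow> (\<forall>e\<in>M. \<forall>f\<in>M. e \<noteq> f \<longrightarrow> (\<forall>i<d. e i < f i) \<or> (\<forall>i<d. f i < e i))"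

lemma strict_chainD:
  "strict_chain d M \<Longrightarrow> e \<in> M \<Longrightarrow> f \<in> M \<Longrightarrow> e \<noteq> f \<Longrightarrow> (\<forall>i<d. e i < f i) \<or> (\<forall>i<d. f i < e i)"
  by (auto simp: strict_chain_def)

lemma strict_chain_empty [simp]: "strict_chain d {}"
  by (simp add: strict_chain_def)

lemma strict_chain_imp_comp_chain: "strict_chain d M \<Longrightarrow> comp_chain d M"
  unfolding strict_chain_def comp_chain_def comp_le_def by (metis order.refl less_imp_le)

text \<open>Disjointness rules out equality in each coordinate, so comparability becomes strict in
  all coordinates at once. Everything below works with this form, which also makes sense for points
  of the cube.\<close>

lemma noncrossing_matching_iff_strict_chain:
  "noncrossing_matching d M \<longleftrightarrow> strict_chain d M"
proof
  assume M: "noncrossing_matching d M"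
  show "strict_chain d M"
    unfolding strict_chain_def
  proof (intro ballI impI)
    fix e f assume ef: "e \<in> M" "f \<in> M" "e \<noteq> f"
    have "disjnt (edge_verts d e) (edge_verts d f)"
      using M ef by (auto simp: noncrossing_matching_def pairwise_def)
    then have "e i \<noteq> f i" if "i < d" for i
      using that by (auto simp: disjnt_def edge_verts_def)
    moreover have "comp_le d e f \<or> comp_le d f e"
      using M ef by (auto simp: noncrossing_matching_def comp_chain_def)
    ultimately show "(\<forall>i<d. e i < f i) \<or> (\<forall>i<d. f i < e i)"
      unfolding comp_le_def by (metis order.strict_iff_order)
  qed
next
  assume M: "strict_chain d M"
  have "disjnt (edge_verts d e) (edge_verts d f)" if "e \<in> M" "f \<in> M" "e \<noteq> f" for e f
    using strict_chainD[OF M that] by (auto simp: disjnt_def edge_verts_def)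
  then show "noncrossing_matching d M"
    using strict_chain_imp_comp_chain[OF M] by (simp add: noncrossing_matching_def pairwise_def)
qed

lemma max_noncrossing_ge:
  assumes "finite G" "M \<subseteq> G" "strict_chain d M"
  shows "card M \<le> max_noncrossing d G"
  unfolding max_noncrossing_def noncrossing_matching_iff_strict_chain
  using assms by (intro Max_ge) auto

lemma max_noncrossing_witness:
  assumes "finite G"
  obtains M where "M \<subseteq> G" "strict_chain d M" "card M = max_noncrossing d G"
proof -
  have "max_noncrossing d G \<in> card ` {M. M \<subseteq> G \<and> strict_chain d M}"
    unfolding max_noncrossing_def noncrossing_matching_iff_strict_chain
    using assms by (intro Max_in) (auto intro!: exI[of _ "{}"])
  then show ?thesis using that by auto
qed

lemma longest_chain_ge:
  assumes "finite S" "C \<subseteq> S" "comp_chain d C"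
  shows "card C \<le> longest_chain d S"
  unfolding longest_chain_def using assms by (intro Max_ge) auto

lemma longest_chain_witness:
  assumes "finite S"
  obtains C where "C \<subseteq> S" "comp_chain d C" "card C = longest_chain d S"
proof -
  have "longest_chain d S \<in> card ` {C. C \<subseteq> S \<and> comp_chain d C}"
    unfolding longest_chain_def
    using assms by (intro Max_in) (auto intro!: exI[of _ "{}"] simp: comp_chain_def)
  then show ?thesis using that by auto
qed

lemma max_noncrossing_mono:
  assumes "finite G'" "G \<subseteq> G'"
  shows "max_noncrossing d G \<le> max_noncrossing d G'"
  by (metis assms finite_subset max_noncrossing_ge max_noncrossing_witness subset_trans)

lemma finite_complete_edges [simp]: "finite (complete_edges d n)"
  by (simp add: complete_edges_def finite_PiE)

lemma card_complete_edges: "card (complete_edges d n) = n ^ d"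
  by (simp add: complete_edges_def card_PiE)

lemma complete_edges_nonempty: "n > 0 \<Longrightarrow> complete_edges d n \<noteq> {}"
  by (simp add: complete_edges_def PiE_eq_empty_iff)

lemma finite_subset_complete_edges: "G \<subseteq> complete_edges d n \<Longrightarrow> finite G"
  by (erule finite_subset) simp

lemma strict_chain_inj_on:
  assumes "strict_chain d M" "i < d"
  shows "inj_on (\<lambda>e. e i) M"
  by (rule inj_onI) (metis assms strict_chainD less_irrefl)

lemma max_noncrossing_le:
  assumes "d > 0" "G \<subseteq> complete_edges d n"
  shows "max_noncrossing d G \<le> n"
proof -
  obtain M where M: "M \<subseteq> G" "strict_chain d M" "card M = max_noncrossing d G"
    using max_noncrossing_witness finite_subset_complete_edges[OF assms(2)] by metis
  have "(\<lambda>e. e 0) ` M \<subseteq> {1..n}"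
    using M(1) assms by (auto simp: complete_edges_def PiE_def Pi_def)
  then have "card M \<le> card {1..n}"
    using strict_chain_inj_on[OF M(2) assms(1)] by (metis card_inj_on_le finite_atLeastAtMost)
  then show ?thesis using M by simp
qed

text \<open>One arbitrary preimage is chosen for each member of the chain. The hypothesis on
  \<open>\<phi>\<close> is the contrapositive of coordinatewise monotonicity, so it is available for
  every map that merges neighbouring cells or points.\<close>

lemma strict_chain_pullback:
  assumes "M \<subseteq> \<phi> ` S" "strict_chain d M"
    and refl: "\<And>x y i. x \<in> S \<Longrightarrow> y \<in> S \<Longrightarrow> i < d \<Longrightarrow> \<phi> x i < \<phi> y i \<Longrightarrow> x i < y i"
  obtains N where "N \<subseteq> S" "strict_chain d N" "card N = card M"
proof -
  define s where "s = inv_into S \<phi>"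
  have s: "s e \<in> S" "\<phi> (s e) = e" if "e \<in> M" for e
    using that assms(1) by (auto simp: s_def inv_into_into f_inv_into_f)
  have "strict_chain d (s ` M)"
    unfolding strict_chain_def
  proof (intro ballI impI)
    fix x y assume xy: "x \<in> s ` M" "y \<in> s ` M" "x \<noteq> y"
    then obtain e f where ef: "e \<in> M" "f \<in> M" "x = s e" "y = s f" by auto
    with xy have "e \<noteq> f" by auto
    then have "(\<forall>i<d. e i < f i) \<or> (\<forall>i<d. f i < e i)"
      using strict_chainD[OF assms(2)] ef by auto
    then show "(\<forall>i<d. x i < y i) \<or> (\<forall>i<d. y i < x i)"
      using refl[of x y] refl[of y x] s ef by auto
  qed
  moreover have "inj_on s M"
    by (metis s(2) inj_onI)
  ultimately show ?thesis
    using that[of "s ` M"] s by (auto simp: card_image)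
qed

section \<open>Translated blocks and superadditivity of the largest matching\<close>

definition shift_edge :: "nat \<Rightarrow> nat \<Rightarrow> (nat \<Rightarrow> nat) \<Rightarrow> nat \<Rightarrow> nat" where
  "shift_edge d a e = (\<lambda>i\<in>{..<d}. a + e i)"

lemma inj_on_shift_edge: "inj_on (shift_edge d a) (complete_edges d n)"
proof (rule inj_onI)
  fix e f assume e: "e \<in> complete_edges d n" and f: "f \<in> complete_edges d n"
    and eq: "shift_edge d a e = shift_edge d a f"
  have "e i = f i" if "i < d" for i
    using that fun_cong[OF eq, of i] by (simp add: shift_edge_def)
  with e f show "e = f"
    unfolding complete_edges_def by (intro PiE_ext) auto
qed

lemma shift_edge_image_subset:
  "shift_edge d a ` complete_edges d b \<subseteq> complete_edges d (a + b)"
  by (force simp: shift_edge_def complete_edges_def PiE_def Pi_def extensional_def)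

lemma complete_edges_mono: "a \<le> b \<Longrightarrow> complete_edges d a \<subseteq> complete_edges d b"
  unfolding complete_edges_def by (intro PiE_mono) auto

lemma shift_edge_disjoint:
  assumes "d > 0"
  shows "complete_edges d a \<inter> shift_edge d a ` complete_edges d b = {}"
proof -
  have False if "e \<in> complete_edges d b" "shift_edge d a e \<in> complete_edges d a" for e
  proof -
    have "e 0 \<ge> 1" "shift_edge d a e 0 \<le> a"
      using that assms by (auto simp: complete_edges_def PiE_def Pi_def)
    then show False using assms by (simp add: shift_edge_def)
  qed
  then show ?thesis by auto
qed

text \<open>Every coordinate is at most \<open>a\<close> in the first block and exceeds
  \<open>a\<close> in the shifted one, so two strict chains can be stacked.\<close>

lemma max_noncrossing_superadditive:
  assumes "d > 0" and G: "G \<subseteq> complete_edges d a" and G': "G' \<subseteq> complete_edges d b"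
  shows "max_noncrossing d G + max_noncrossing d G' \<le> max_noncrossing d (G \<union> shift_edge d a ` G')"
proof -
  note fin = finite_subset_complete_edges[OF G] finite_subset_complete_edges[OF G']
  obtain M where M: "M \<subseteq> G" "strict_chain d M" "card M = max_noncrossing d G"
    using max_noncrossing_witness[OF fin(1)] by metis
  obtain M' where M': "M' \<subseteq> G'" "strict_chain d M'" "card M' = max_noncrossing d G'"
    using max_noncrossing_witness[OF fin(2)] by metis
  let ?s = "shift_edge d a"
  have less: "\<forall>i<d. e i < ?s f i" if "e \<in> M" "f \<in> M'" for e f
  proof (intro allI impI)
    fix i assume "i < d"
    then have "e i \<le> a" "f i \<ge> 1"
      using that M M' G G' by (auto simp: complete_edges_def PiE_def Pi_def subset_iff)
    then show "e i < ?s f i" using \<open>i < d\<close> by (simp add: shift_edge_def)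
  qed
  have "strict_chain d (M \<union> ?s ` M')"
    unfolding strict_chain_def
  proof (intro ballI impI)
    fix e f assume ef: "e \<in> M \<union> ?s ` M'" "f \<in> M \<union> ?s ` M'" "e \<noteq> f"
    consider "e \<in> M" "f \<in> M" | "e \<in> M" "f \<in> ?s ` M'" | "f \<in> M" "e \<in> ?s ` M'"
      | x y where "x \<in> M'" "y \<in> M'" "e = ?s x" "f = ?s y"
      using ef by auto
    then show "(\<forall>i<d. e i < f i) \<or> (\<forall>i<d. f i < e i)"
    proof cases
      case 1 then show ?thesis using strict_chainD[OF M(2)] ef by auto
    next
      case 2 then show ?thesis using less by auto
    next
      case 3 then show ?thesis using less by auto
    next
      case 4
      then have "x \<noteq> y" using ef by auto
      then show ?thesis using strict_chainD[OF M'(2)] 4 by (auto simp: shift_edge_def)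
    qed
  qed
  then have "card (M \<union> ?s ` M') \<le> max_noncrossing d (G \<union> ?s ` G')"
    using fin M M' by (intro max_noncrossing_ge) auto
  moreover have "card (?s ` M') = card M'"
    using M' G' by (intro card_image inj_on_subset[OF inj_on_shift_edge]) auto
  moreover have "M \<inter> ?s ` M' = {}"
    using shift_edge_disjoint[OF assms(1)] M M' G G' by blast
  ultimately show ?thesis
    using M M' fin by (subst (asm) card_Un_disjoint) (auto intro: finite_subset)
qed

text \<open>In a strict chain every edge has the same rank in each coordinate, so the chain is determined
  by its coordinate projections; hence there are at most \<open>(n choose k)^d\<close> of size \<open>k\<close>.\<close>

lemma strict_chain_eq_of_projections:
  assumes d: "d > 0" and fin: "finite M"
    and M: "M \<subseteq> extensional {..<d}" "strict_chain d M"
  shows "M = {e \<in> extensional {..<d}. \<forall>i<d. e i \<in> (\<lambda>f. f i) ` M \<and>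
           card {a \<in> (\<lambda>f. f i) ` M. a < e i} = card {a \<in> (\<lambda>f. f 0) ` M. a < e 0}}" (is "_ = ?R")
proof -
  \<comment> \<open>Within a strict chain the order can be read off from any single coordinate,
    hence the rank is the same in all of them.\<close>
  have rank: "card {a \<in> (\<lambda>f. f i) ` M. a < e i} = card {f \<in> M. f 0 < e 0}" if "e \<in> M" "i < d" for e i
  proof -
    have "{a \<in> (\<lambda>f. f i) ` M. a < e i} = (\<lambda>f. f i) ` {f \<in> M. f i < e i}" by auto
    moreover have "{f \<in> M. f i < e i} = {f \<in> M. f 0 < e 0}"
    proof -
      have "f i < e i \<longleftrightarrow> f 0 < e 0" if "f \<in> M" for f
        using strict_chainD[OF M(2) \<open>f \<in> M\<close> \<open>e \<in> M\<close>] d \<open>i < d\<close>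
        by (metis less_asym less_irrefl)
      then show ?thesis by auto
    qed
    ultimately show ?thesis
      using card_image[OF inj_on_subset[OF strict_chain_inj_on[OF M(2) \<open>i < d\<close>]], of "{f \<in> M. f 0 < e 0}"]
      by auto
  qed
  have "M \<subseteq> ?R"
    using M(1) rank d by (auto simp: subset_iff)
  moreover have "e \<in> M" if e: "e \<in> ?R" for e
  proof -
    have e': "e i \<in> (\<lambda>f. f i) ` M"
      "card {a \<in> (\<lambda>f. f i) ` M. a < e i} = card {a \<in> (\<lambda>f. f 0) ` M. a < e 0}" if "i < d" for i
      using e that by blast+
    obtain f where f: "f \<in> M" "f 0 = e 0" using e'(1)[OF d] by (metis imageE)
    have "e i = f i" if i: "i < d" for i
    proof -
      let ?A = "(\<lambda>f. f i) ` M"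
      \<comment> \<open>\<open>f\<close> is the member of \<open>M\<close> that agrees with
        \<open>e\<close> in coordinate 0. Both then have equal ranks in the finite linear order
        \<open>?A\<close>, and a rank determines an element.\<close>
      have *: "card {a \<in> ?A. a < e i} = card {a \<in> ?A. a < f i}"
        using e'(2)[OF i] rank[OF f(1) i] rank[OF f(1) d] unfolding f(2) by presburger
      have **: "\<not> u < v" if "card {a \<in> ?A. a < u} = card {a \<in> ?A. a < v}" "u \<in> ?A" for u v
      proof
        assume "u < v"
        then have "{a \<in> ?A. a < u} \<subset> {a \<in> ?A. a < v}" using that(2) by force
        then have "card {a \<in> ?A. a < u} < card {a \<in> ?A. a < v}"
          using fin by (intro psubset_card_mono) simp_all
        then show False using that(1) by simp
      qed
      have "e i \<in> ?A" "f i \<in> ?A" using e'(1)[OF i] f(1) by simp_all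
      then show ?thesis using **[OF *] **[OF *[symmetric]] by (meson linorder_neqE)
    qed
    then have "e = f"
      using e f(1) M(1) by (intro extensionalityI[of e "{..<d}"]) blast+
    with f show ?thesis by simp
  qed
  ultimately show ?thesis by blast
qed

lemma card_strict_chains_le:
  assumes d: "d > 0"
  shows "card {M. M \<subseteq> complete_edges d n \<and> strict_chain d M \<and> card M = k} \<le> (n choose k) ^ d"
proof -
  let ?C = "{M. M \<subseteq> complete_edges d n \<and> strict_chain d M \<and> card M = k}"
  let ?P = "\<Pi>\<^sub>E i\<in>{..<d}. {A. A \<subseteq> {1..n} \<and> card A = k}"
  define \<pi> :: "(nat \<Rightarrow> nat) set \<Rightarrow> nat \<Rightarrow> nat set" where "\<pi> M = (\<lambda>i\<in>{..<d}. (\<lambda>f. f i) ` M)" for M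
  have "inj_on \<pi> ?C"
  proof (rule inj_onI)
    fix M N assume M: "M \<in> ?C" and N: "N \<in> ?C" and eq: "\<pi> M = \<pi> N"
    have ext: "complete_edges d n \<subseteq> extensional {..<d}" unfolding complete_edges_def PiE_def by (rule Int_lower2)
    have pr: "(\<lambda>f. f i) ` M = (\<lambda>f. f i) ` N" if "i < d" for i
      using fun_cong[OF eq, of i] that by (simp add: \<pi>_def)
    have "M = {e \<in> extensional {..<d}. \<forall>i<d. e i \<in> (\<lambda>f. f i) ` M \<and>
           card {a \<in> (\<lambda>f. f i) ` M. a < e i} = card {a \<in> (\<lambda>f. f 0) ` M. a < e 0}}"
      using M ext d by (intro strict_chain_eq_of_projections) (auto intro: finite_subset_complete_edges)
    also have "\<dots> = {e \<in> extensional {..<d}. \<forall>i<d. e i \<in> (\<lambda>f. f i) ` N \<and>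
           card {a \<in> (\<lambda>f. f i) ` N. a < e i} = card {a \<in> (\<lambda>f. f 0) ` N. a < e 0}}"
      using pr d by auto
    also have "\<dots> = N"
      using N ext d by (intro strict_chain_eq_of_projections[symmetric]) (auto intro: finite_subset_complete_edges)
    finally show "M = N" .
  qed
  moreover have "\<pi> ` ?C \<subseteq> ?P"
  proof
    fix x assume "x \<in> \<pi> ` ?C"
    then obtain M where M: "M \<in> ?C" "x = \<pi> M" by auto
    have "(\<lambda>f. f i) ` M \<subseteq> {1..n} \<and> card ((\<lambda>f. f i) ` M) = k" if "i < d" for i
    proof
      show "(\<lambda>f. f i) ` M \<subseteq> {1..n}"
        using M that by (auto simp: complete_edges_def PiE_def Pi_def subset_iff)
      show "card ((\<lambda>f. f i) ` M) = k"
        using M strict_chain_inj_on[OF _ that, of M] by (simp add: card_image)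
    qed
    then show "x \<in> ?P" using M(2) by (auto simp: \<pi>_def)
  qed
  moreover have "finite ?P" by (intro finite_PiE) auto
  ultimately have "card ?C \<le> card ?P" by (rule card_inj_on_le)
  also have "card ?P = (n choose k) ^ d"
    by (simp add: card_PiE n_subsets)
  finally show ?thesis .
qed

subsection \<open>Random subsets of a finite set\<close>

text \<open>Moebius inversion on the subset lattice, done by induction: once all proper subsets of
  \<open>S\<close> agree, the sum over \<open>Pow S\<close> isolates the term at
  \<open>S\<close>.\<close>

lemma eq_on_Pow_of_downset_sums:
  fixes g h :: "'a set \<Rightarrow> real"
  assumes "finite A" and eq: "\<And>T. T \<subseteq> A \<Longrightarrow> (\<Sum>S\<in>Pow T. g S) = (\<Sum>S\<in>Pow T. h S)"
    and "S \<subseteq> A"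
  shows "g S = h S"
  using finite_subset[OF \<open>S \<subseteq> A\<close> \<open>finite A\<close>] \<open>S \<subseteq> A\<close>
proof (induction S rule: finite_psubset_induct)
  case (psubset S)
  have split: "(\<Sum>U\<in>Pow S. f U) = f S + (\<Sum>U\<in>Pow S - {S}. f U)" for f :: "'a set \<Rightarrow> real"
    using psubset.hyps by (simp add: sum.remove)
  have "(\<Sum>U\<in>Pow S - {S}. g U) = (\<Sum>U\<in>Pow S - {S}. h U)"
    using psubset by (intro sum.cong refl psubset.IH) auto
  with eq[OF psubset.prems] show ?case by (simp add: split)
qed

lemma prob_subset_eq_sum_pmf:
  assumes "finite T"
  shows "measure_pmf.prob M {S. S \<subseteq> T} = (\<Sum>S\<in>Pow T. pmf M S)"
  using assms by (simp add: Pow_def[symmetric] measure_measure_pmf_finite)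

text \<open>The tool behind all identities in law between random edge sets: only the probabilities
  of lying inside a fixed set have to be compared.\<close>

lemma random_set_eqI:
  assumes A: "finite A" and M: "set_pmf M \<subseteq> Pow A" and N: "set_pmf N \<subseteq> Pow A"
    and eq: "\<And>T. T \<subseteq> A \<Longrightarrow> measure_pmf.prob M {S. S \<subseteq> T} = measure_pmf.prob N {S. S \<subseteq> T}"
  shows "M = N"
proof (rule pmf_eqI)
  fix S
  show "pmf M S = pmf N S"
  proof (cases "S \<subseteq> A")
    case True
    have "(\<Sum>S\<in>Pow T. pmf M S) = (\<Sum>S\<in>Pow T. pmf N S)" if "T \<subseteq> A" for T
      using eq[OF that] prob_subset_eq_sum_pmf[OF finite_subset[OF that A]] by simp
    then show ?thesis using True by (rule eq_on_Pow_of_downset_sums[OF A])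
  next
    case False
    then have "S \<notin> set_pmf M" "S \<notin> set_pmf N" using M N by auto
    then show ?thesis by (simp add: set_pmf_iff)
  qed
qed

definition random_subset :: "'a set \<Rightarrow> real \<Rightarrow> 'a set pmf" where
  "random_subset A p = map_pmf (\<lambda>b. {e \<in> A. b e}) (Pi_pmf A False (\<lambda>_. bernoulli_pmf p))"

lemma random_hypergraph_eq: "random_hypergraph d n p = random_subset (complete_edges d n) p"
  by (simp add: random_hypergraph_def random_subset_def)

lemma set_random_subset: "set_pmf (random_subset A p) \<subseteq> Pow A"
  by (auto simp: random_subset_def)

lemma finite_set_random_subset [simp]: "finite A \<Longrightarrow> finite (set_pmf (random_subset A p))"
  using set_random_subset finite_subset by (metis finite_Pow_iff)

lemma prob_random_subset:
  assumes "finite A" "0 \<le> p" "p \<le> 1"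
  shows "measure_pmf.prob (random_subset A p) {S. S \<subseteq> T} = (1 - p) ^ card (A - T)"
proof -
  have "measure_pmf.prob (random_subset A p) {S. S \<subseteq> T} =
    measure_pmf.prob (Pi_pmf A False (\<lambda>_. bernoulli_pmf p)) (Pi A (\<lambda>e. {b. b \<longrightarrow> e \<in> T}))"
    unfolding random_subset_def by (auto intro!: arg_cong[where f = "measure_pmf.prob _"])
  also have "\<dots> = (\<Prod>e\<in>A. measure_pmf.prob (bernoulli_pmf p) {b. b \<longrightarrow> e \<in> T})"
    using assms(1) by (rule measure_Pi_pmf_Pi)
  also have "\<dots> = (\<Prod>e\<in>A. if e \<in> A - T then 1 - p else 1)"
  proof (rule prod.cong[OF refl])
    fix e assume "e \<in> A"
    have "{b. b \<longrightarrow> e \<in> T} = (if e \<in> T then UNIV else {False})" by auto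
    then show "measure_pmf.prob (bernoulli_pmf p) {b. b \<longrightarrow> e \<in> T} = (if e \<in> A - T then 1 - p else 1)"
      using \<open>e \<in> A\<close> assms by (simp add: measure_pmf_single)
  qed
  also have "\<dots> = (1 - p) ^ card (A - T)"
    using assms(1) by (subst prod.If_cases) (auto simp: Int_def set_diff_eq)
  finally show ?thesis .
qed

lemma prob_superset_random_subset:
  assumes "finite A" "0 \<le> p" "p \<le> 1" "T \<subseteq> A"
  shows "measure_pmf.prob (random_subset A p) {S. T \<subseteq> S} = p ^ card T"
proof -
  have "measure_pmf.prob (random_subset A p) {S. T \<subseteq> S} =
    measure_pmf.prob (Pi_pmf A False (\<lambda>_. bernoulli_pmf p)) (Pi A (\<lambda>e. {b. e \<in> T \<longrightarrow> b}))"
    using assms(4) unfolding random_subset_def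
    by (auto intro!: arg_cong[where f = "measure_pmf.prob _"] simp: subset_iff)
  also have "\<dots> = (\<Prod>e\<in>A. measure_pmf.prob (bernoulli_pmf p) {b. e \<in> T \<longrightarrow> b})"
    using assms(1) by (rule measure_Pi_pmf_Pi)
  also have "\<dots> = (\<Prod>e\<in>A. if e \<in> T then p else 1)"
  proof (rule prod.cong[OF refl])
    fix e assume "e \<in> A"
    have "{b. e \<in> T \<longrightarrow> b} = (if e \<in> T then {True} else UNIV)" by auto
    then show "measure_pmf.prob (bernoulli_pmf p) {b. e \<in> T \<longrightarrow> b} = (if e \<in> T then p else 1)"
      using assms by (simp add: measure_pmf_single)
  qed
  also have "\<dots> = p ^ card T"
    using assms(1,4) by (subst prod.If_cases) (auto simp: Int_absorb1)
  finally show ?thesis .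
qed

text \<open>\<open>F\<close> and \<open>G\<close> form a Galois connection, so the event that the
  image lies in \<open>T\<close> pulls back to the event that the original set lies in
  \<open>G T\<close>. What remains is to compare two powers. Restriction, injective images and block
  merging are all instances.\<close>

lemma random_subset_map_eqI:
  assumes "finite A" "0 \<le> p" "p \<le> 1" "finite B" "0 \<le> q" "q \<le> 1"
    and range: "\<And>S. S \<subseteq> A \<Longrightarrow> F S \<subseteq> B"
    and sub: "\<And>S T. S \<subseteq> A \<Longrightarrow> T \<subseteq> B \<Longrightarrow> F S \<subseteq> T \<longleftrightarrow> S \<subseteq> G T"
    and eq: "\<And>T. T \<subseteq> B \<Longrightarrow> (1 - p) ^ card (A - G T) = (1 - q) ^ card (B - T)"
  shows "map_pmf F (random_subset A p) = random_subset B q"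
proof (rule random_set_eqI[OF assms(4)])
  show "set_pmf (map_pmf F (random_subset A p)) \<subseteq> Pow B"
    using set_random_subset[of A p] range unfolding set_map_pmf by blast
  fix T assume T: "T \<subseteq> B"
  have "measure_pmf.prob (map_pmf F (random_subset A p)) {S. S \<subseteq> T} =
      measure_pmf.prob (random_subset A p) {S. F S \<subseteq> T}"
    by (simp add: vimage_def)
  also have "\<dots> = measure_pmf.prob (random_subset A p) {S. S \<subseteq> G T}"
  proof (rule measure_pmf.finite_measure_eq_AE)
    have "F S \<subseteq> T \<longleftrightarrow> S \<subseteq> G T" if "S \<in> set_pmf (random_subset A p)" for S
      using that set_random_subset[of A p] sub[OF _ T, of S] by blast
    then show "AE S in random_subset A p. (S \<in> {S. F S \<subseteq> T}) = (S \<in> {S. S \<subseteq> G T})"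
      by (simp add: AE_measure_pmf_iff)
  qed simp_all
  finally show "measure_pmf.prob (map_pmf F (random_subset A p)) {S. S \<subseteq> T} =
      measure_pmf.prob (random_subset B q) {S. S \<subseteq> T}"
    using assms eq[OF T] by (simp add: prob_random_subset)
qed (rule set_random_subset)

lemma random_subset_restrict:
  assumes "finite B" "A \<subseteq> B" "0 \<le> p" "p \<le> 1"
  shows "map_pmf (\<lambda>S. S \<inter> A) (random_subset B p) = random_subset A p"
proof (rule random_subset_map_eqI[where G = "\<lambda>T. T \<union> (B - A)"])
  show "(1 - p) ^ card (B - (T \<union> (B - A))) = (1 - p) ^ card (A - T)" for T
    using assms(2) by (intro arg_cong[where f = "\<lambda>X. (1 - p) ^ card X"]) auto
qed (use assms in \<open>auto intro: finite_subset\<close>)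

lemma random_subset_image:
  assumes "finite A" "inj_on f A" "0 \<le> p" "p \<le> 1"
  shows "map_pmf (image f) (random_subset A p) = random_subset (f ` A) p"
proof (rule random_subset_map_eqI[where G = "\<lambda>T. {a \<in> A. f a \<in> T}"])
  show "(1 - p) ^ card (A - {a \<in> A. f a \<in> T}) = (1 - p) ^ card (f ` A - T)" for T
  proof -
    have "f ` A - T = f ` (A - {a \<in> A. f a \<in> T})" by auto
    then show ?thesis
      using card_image[OF inj_on_subset[OF assms(2)], of "A - {a \<in> A. f a \<in> T}"] by auto
  qed
qed (use assms in auto)

lemma measure_pair_pmf_Times:
  "measure_pmf.prob (pair_pmf M N) (X \<times> Y) = measure_pmf.prob M X * measure_pmf.prob N Y"
proof -
  have "emeasure (pair_pmf M N) (X \<times> Y) = emeasure M X * emeasure N Y"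
  proof -
    have "emeasure (pair_pmf M N) (X \<times> Y) = (\<integral>\<^sup>+ z. indicator (X \<times> Y) z \<partial>pair_pmf M N)"
      by simp
    also have "\<dots> = (\<integral>\<^sup>+ a. \<integral>\<^sup>+ b. indicator X a * indicator Y b \<partial>N \<partial>M)"
      by (simp add: nn_integral_pair_pmf' indicator_times del: nn_integral_indicator)
    also have "\<dots> = emeasure M X * emeasure N Y"
      by (simp add: nn_integral_cmult nn_integral_multc)
    finally show ?thesis .
  qed
  then show ?thesis
    by (simp add: measure_pmf.emeasure_eq_measure ennreal_mult[symmetric])
qed

text \<open>The sets \<open>A\<close> and \<open>B\<close> may overlap. The hypothesis
  \<open>eq\<close> covers both cases that occur: disjoint sets with one common probability, and
  \<open>A = B\<close> with \<open>(1 - p) * (1 - q) = 1 - r\<close>.\<close>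

lemma random_subset_Un:
  assumes fin: "finite A" "finite B" and p: "0 \<le> p" "p \<le> 1" "0 \<le> q" "q \<le> 1" "0 \<le> r" "r \<le> 1"
    and eq: "\<And>T. T \<subseteq> A \<union> B \<Longrightarrow> (1 - p) ^ card (A - T) * (1 - q) ^ card (B - T) = (1 - r) ^ card (A \<union> B - T)"
  shows "map_pmf (\<lambda>(S, S'). S \<union> S') (pair_pmf (random_subset A p) (random_subset B q)) =
    random_subset (A \<union> B) r"
proof (rule random_set_eqI)
  fix T assume T: "T \<subseteq> A \<union> B"
  have "measure_pmf.prob (map_pmf (\<lambda>(S, S'). S \<union> S')
          (pair_pmf (random_subset A p) (random_subset B q))) {S. S \<subseteq> T} =
      measure_pmf.prob (pair_pmf (random_subset A p) (random_subset B q)) ({S. S \<subseteq> T} \<times> {S. S \<subseteq> T})"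
    by (auto intro!: arg_cong[where f = "measure_pmf.prob _"])
  then show "measure_pmf.prob (map_pmf (\<lambda>(S, S'). S \<union> S')
          (pair_pmf (random_subset A p) (random_subset B q))) {S. S \<subseteq> T} =
      measure_pmf.prob (random_subset (A \<union> B) r) {S. S \<subseteq> T}"
    using fin p eq[OF T] by (simp add: measure_pair_pmf_Times prob_random_subset)
qed (use fin set_random_subset[of A p] set_random_subset[of B q] set_random_subset[of "A \<union> B" r] in auto)

lemma random_subset_disjoint_Un:
  assumes "finite A" "finite B" "A \<inter> B = {}" "0 \<le> p" "p \<le> 1"
  shows "map_pmf (\<lambda>(S, S'). S \<union> S') (pair_pmf (random_subset A p) (random_subset B p)) =
    random_subset (A \<union> B) p"
proof (rule random_subset_Un)
  fix T
  have "card (A \<union> B - T) = card (A - T) + card (B - T)"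
    using assms by (subst card_Un_disjoint[symmetric]) (auto simp: Un_Diff)
  then show "(1 - p) ^ card (A - T) * (1 - p) ^ card (B - T) = (1 - p) ^ card (A \<union> B - T)"
    by (simp add: power_add)
qed (use assms in auto)

lemma expectation_pair_pmf_finite:
  fixes f :: "'a \<times> 'b \<Rightarrow> real"
  assumes "finite (set_pmf M)" "finite (set_pmf N)"
  shows "measure_pmf.expectation (pair_pmf M N) f =
    measure_pmf.expectation M (\<lambda>a. measure_pmf.expectation N (\<lambda>b. f (a, b)))"
proof -
  have "measure_pmf.expectation (pair_pmf M N) f = (\<Sum>z\<in>set_pmf M \<times> set_pmf N. f z * (pmf M (fst z) * pmf N (snd z)))"
    using assms by (subst integral_measure_pmf_real[where A = "set_pmf M \<times> set_pmf N"])
      (auto simp: pmf_pair split_beta intro!: sum.cong)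
  also have "\<dots> = (\<Sum>a\<in>set_pmf M. (\<Sum>b\<in>set_pmf N. f (a, b) * pmf N b) * pmf M a)"
    by (subst sum.cartesian_product') (simp add: sum_distrib_left sum_distrib_right mult_ac)
  also have "\<dots> = measure_pmf.expectation M (\<lambda>a. measure_pmf.expectation N (\<lambda>b. f (a, b)))"
    using assms by (simp add: integral_measure_pmf_real[where A = "set_pmf M"] integral_measure_pmf_real[where A = "set_pmf N"])
  finally show ?thesis .
qed

lemma expectation_pmf_mono:
  fixes f g :: "'a \<Rightarrow> real"
  assumes "finite (set_pmf M)" "\<And>x. x \<in> set_pmf M \<Longrightarrow> f x \<le> g x"
  shows "measure_pmf.expectation M f \<le> measure_pmf.expectation M g"
  using assms by (intro integral_mono_AE integrable_measure_pmf_finite) (auto simp: AE_measure_pmf_iff)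

subsection \<open>Superadditivity, refinement and the lower tail\<close>

abbreviation rand_edges :: "nat \<Rightarrow> nat \<Rightarrow> real \<Rightarrow> (nat \<Rightarrow> nat) set pmf" where
  "rand_edges d n p \<equiv> random_subset (complete_edges d n) p"

lemma expected_L_eq:
  "expected_L d p n = measure_pmf.expectation (rand_edges d n p) (\<lambda>S. real (max_noncrossing d S))"
  by (simp add: expected_L_def random_hypergraph_eq)

lemma set_rand_edges: "S \<in> set_pmf (rand_edges d n p) \<Longrightarrow> S \<subseteq> complete_edges d n"
  using set_random_subset[of "complete_edges d n" p] by auto

lemma finite_in_rand_edges: "S \<in> set_pmf (rand_edges d n p) \<Longrightarrow> finite S"
  by (rule finite_subset_complete_edges[OF set_rand_edges])

text \<open>The two diagonal blocks of the large grid carry independent copies, and all edges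
  outside them are discarded by monotonicity. A general increasing \<open>\<Phi>\<close> allows one
  proof to serve both the mean and the Laplace transform.\<close>

lemma expectation_mono_superadditive:
  fixes \<Phi> :: "nat \<Rightarrow> real"
  assumes d: "d > 0" and p: "0 \<le> p" "p \<le> 1" and mono: "mono \<Phi>"
  shows "measure_pmf.expectation (rand_edges d a p) (\<lambda>S.
           measure_pmf.expectation (rand_edges d b p) (\<lambda>S'. \<Phi> (max_noncrossing d S + max_noncrossing d S')))
    \<le> measure_pmf.expectation (rand_edges d (a + b) p) (\<lambda>S. \<Phi> (max_noncrossing d S))"
proof -
  let ?A = "complete_edges d a" and ?B = "shift_edge d a ` complete_edges d b"
  let ?C = "complete_edges d (a + b)"
  let ?L = "max_noncrossing d"
  have sub: "?A \<union> ?B \<subseteq> ?C"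
    using complete_edges_mono[of a "a + b"] shift_edge_image_subset by simp
  have rB: "random_subset ?B p = map_pmf (image (shift_edge d a)) (rand_edges d b p)"
    using random_subset_image[OF finite_complete_edges inj_on_shift_edge p] by simp
  have "measure_pmf.expectation (rand_edges d a p) (\<lambda>S.
           measure_pmf.expectation (rand_edges d b p) (\<lambda>S'. \<Phi> (?L S + ?L S')))
    \<le> measure_pmf.expectation (rand_edges d a p) (\<lambda>S.
           measure_pmf.expectation (rand_edges d b p) (\<lambda>S'. \<Phi> (?L (S \<union> shift_edge d a ` S'))))"
    by (intro expectation_pmf_mono finite_set_random_subset finite_complete_edges monoD[OF mono]
        max_noncrossing_superadditive d set_rand_edges)
  also have "\<dots> = measure_pmf.expectation (rand_edges d a p) (\<lambda>S.
           measure_pmf.expectation (random_subset ?B p) (\<lambda>S'. \<Phi> (?L (S \<union> S'))))"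
    by (simp add: rB)
  also have "\<dots> = measure_pmf.expectation (pair_pmf (rand_edges d a p) (random_subset ?B p))
         (\<lambda>(S, S'). \<Phi> (?L (S \<union> S')))"
    by (subst expectation_pair_pmf_finite) simp_all
  also have "\<dots> = measure_pmf.expectation (map_pmf (\<lambda>(S, S'). S \<union> S')
         (pair_pmf (rand_edges d a p) (random_subset ?B p))) (\<lambda>S. \<Phi> (?L S))"
    by (simp add: case_prod_unfold)
  also have "\<dots> = measure_pmf.expectation (random_subset (?A \<union> ?B) p) (\<lambda>S. \<Phi> (?L S))"
    by (subst random_subset_disjoint_Un) (simp_all add: p shift_edge_disjoint d)
  also have "\<dots> = measure_pmf.expectation (random_subset ?C p) (\<lambda>S. \<Phi> (?L (S \<inter> (?A \<union> ?B))))"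
    by (subst random_subset_restrict[OF _ sub p, symmetric]) simp_all
  also have "\<dots> \<le> measure_pmf.expectation (random_subset ?C p) (\<lambda>S. \<Phi> (?L S))"
    by (intro expectation_pmf_mono finite_set_random_subset finite_complete_edges monoD[OF mono]
        max_noncrossing_mono finite_in_rand_edges Int_lower1)
  finally show ?thesis .
qed

lemma integrable_rand_edges [simp]: "integrable (rand_edges d n p) (f :: _ \<Rightarrow> real)"
  by (simp add: integrable_measure_pmf_finite)

lemma expected_L_superadditive:
  assumes "d > 0" "0 \<le> p" "p \<le> 1"
  shows "expected_L d p a + expected_L d p b \<le> expected_L d p (a + b)"
  using expectation_mono_superadditive[OF assms, of real a b]
  by (simp add: expected_L_eq monoI)

lemma expected_L_nonneg: "0 \<le> expected_L d p n"
  by (simp add: expected_L_eq)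

lemma expected_L_le:
  assumes "d > 0"
  shows "expected_L d p n \<le> n"
proof -
  have "expected_L d p n \<le> measure_pmf.expectation (rand_edges d n p) (\<lambda>_. real n)"
    unfolding expected_L_eq
    by (intro expectation_pmf_mono) (auto intro!: max_noncrossing_le[OF assms] dest: set_rand_edges)
  then show ?thesis by simp
qed

lemma expected_L_mult_le:
  assumes "d > 0" "0 \<le> p" "p \<le> 1"
  shows "real k * expected_L d p n \<le> expected_L d p (k * n)"
proof (induction k)
  case 0 then show ?case by (simp add: expected_L_nonneg)
next
  case (Suc k)
  then show ?case using expected_L_superadditive[OF assms, of n "k * n"] by (simp add: algebra_simps)
qed

text \<open>Sprinkling: the graph with parameter \<open>q\<close> is the union of one with parameter
  \<open>p\<close> and an independent one with parameter \<open>r\<close>, where \<open>r\<close>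
  solves \<open>(1 - p) * (1 - r) = 1 - q\<close>.\<close>

lemma expected_L_mono_p:
  assumes "0 \<le> p" "p \<le> q" "q < 1"
  shows "expected_L d p n \<le> expected_L d q n"
proof -
  define r where "r = 1 - (1 - q) / (1 - p)"
  have r: "0 \<le> r" "r \<le> 1" "(1 - p) * (1 - r) = 1 - q" using assms by (auto simp: r_def divide_simps)
  let ?R = "rand_edges d n" and ?L = "max_noncrossing d"
  have eq: "map_pmf (\<lambda>(S, S'). S \<union> S') (pair_pmf (?R p) (?R r)) = ?R q"
    using random_subset_Un[of "complete_edges d n" "complete_edges d n" p r q] assms r
    by (simp flip: power_mult_distrib)
  have "expected_L d p n = measure_pmf.expectation (pair_pmf (?R p) (?R r)) (\<lambda>z. real (?L (fst z)))"
    using expectation_pair_pmf_fst[of "?R p" "?R r" "\<lambda>S. real (?L S)"] by (simp add: expected_L_eq)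
  also have "\<dots> \<le> measure_pmf.expectation (pair_pmf (?R p) (?R r)) (\<lambda>z. real (?L (fst z \<union> snd z)))"
    by (intro expectation_pmf_mono)
      (auto intro!: max_noncrossing_mono dest: finite_in_rand_edges)
  also have "\<dots> = expected_L d q n"
    unfolding expected_L_eq eq[symmetric] by (simp add: case_prod_unfold)
  finally show ?thesis .
qed

text \<open>Labels start at 1, so they are moved to 0 for the division and back afterwards. Label
  \<open>v\<close> of the coarse grid then stands for the fine labels from
  \<open>(v - 1) * k + 1\<close> to \<open>v * k\<close>.\<close>

definition coarsen :: "nat \<Rightarrow> nat \<Rightarrow> (nat \<Rightarrow> nat) \<Rightarrow> nat \<Rightarrow> nat" where
  "coarsen d k e = (\<lambda>i\<in>{..<d}. (e i - 1) div k + 1)"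

lemma coarsen_fibre:
  assumes k: "k > 0" and f: "f \<in> complete_edges d n"
  shows "{e \<in> complete_edges d (k * n). coarsen d k e = f} = (\<Pi>\<^sub>E i\<in>{..<d}. {(f i - 1) * k + 1..f i * k})"
proof -
  have iff: "(1 \<le> x \<and> x \<le> k * n \<and> (x - 1) div k + 1 = v) \<longleftrightarrow> (v - 1) * k + 1 \<le> x \<and> x \<le> v * k"
    if v: "1 \<le> v" "v \<le> n" for x v
  proof -
    obtain w where w: "v = Suc w" using v by (cases v) auto
    have vk: "v * k \<le> k * n" using v by (simp add: mult.commute)
    show ?thesis
    proof (cases x)
      case (Suc y)
      have "y div k = w \<longleftrightarrow> w * k \<le> y \<and> y < Suc w * k"
        using k by (metis div_nat_eqI dividend_less_times_div div_times_less_eq_dividend mult.commute mult_Suc)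
      then show ?thesis using Suc w vk by auto
    qed (use w k in auto)
  qed
  have fi: "1 \<le> f i" "f i \<le> n" if "i < d" for i
    using f that by (auto simp: complete_edges_def PiE_def Pi_def)
  show ?thesis
  proof (intro set_eqI iffI)
    fix e assume "e \<in> {e \<in> complete_edges d (k * n). coarsen d k e = f}"
    then have e: "e \<in> complete_edges d (k * n)" "coarsen d k e = f" by auto
    show "e \<in> (\<Pi>\<^sub>E i\<in>{..<d}. {(f i - 1) * k + 1..f i * k})"
    proof (rule PiE_I)
      fix i assume "i \<in> {..<d}"
      then have "1 \<le> e i \<and> e i \<le> k * n \<and> (e i - 1) div k + 1 = f i"
        using e by (auto simp: complete_edges_def PiE_def Pi_def coarsen_def)
      with iff[OF fi] \<open>i \<in> {..<d}\<close> show "e i \<in> {(f i - 1) * k + 1..f i * k}" by simp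
    next
      fix i assume "i \<notin> {..<d}"
      then show "e i = undefined" using e by (auto simp: complete_edges_def)
    qed
  next
    fix e assume e: "e \<in> (\<Pi>\<^sub>E i\<in>{..<d}. {(f i - 1) * k + 1..f i * k})"
    have *: "1 \<le> e i \<and> e i \<le> k * n \<and> (e i - 1) div k + 1 = f i" if "i < d" for i
    proof -
      have "e i \<in> {(f i - 1) * k + 1..f i * k}" using e that by blast
      then show ?thesis using iff[OF fi[OF that], of "e i"] by auto
    qed
    have "coarsen d k e = f"
    proof
      fix i show "coarsen d k e i = f i"
        using * f by (cases "i < d") (auto simp: coarsen_def complete_edges_def)
    qed
    moreover have "e \<in> complete_edges d (k * n)"
      using * e by (auto simp: complete_edges_def PiE_def)
    ultimately show "e \<in> {e \<in> complete_edges d (k * n). coarsen d k e = f}" by simp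
  qed
qed

lemma card_coarsen_fibre:
  assumes "k > 0" "f \<in> complete_edges d n"
  shows "card {e \<in> complete_edges d (k * n). coarsen d k e = f} = k ^ d"
proof -
  have "card {(f i - 1) * k + 1..f i * k} = k" if "i < d" for i
  proof -
    have "f i \<ge> 1" using assms(2) that by (auto simp: complete_edges_def PiE_def Pi_def)
    then obtain w where "f i = Suc w" by (cases "f i") auto
    then show ?thesis by simp
  qed
  then show ?thesis unfolding coarsen_fibre[OF assms] by (simp add: card_PiE)
qed

lemma coarsen_in:
  assumes "k > 0" "e \<in> complete_edges d (k * n)"
  shows "coarsen d k e \<in> complete_edges d n"
proof -
  have "(e i - 1) div k + 1 \<le> n" if "i < d" for i
  proof -
    have "1 \<le> e i" "e i \<le> k * n" using assms(2) that by (auto simp: complete_edges_def PiE_def Pi_def)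
    then have "e i - 1 < n * k" by (simp add: mult.commute)
    then have "(e i - 1) div k < n" by (simp add: less_mult_imp_div_less)
    then show ?thesis by simp
  qed
  then show ?thesis by (auto simp: coarsen_def complete_edges_def)
qed

text \<open>A coarse edge is missing iff all \<open>k ^ d\<close> fine edges of its block are
  missing, each with probability \<open>exp (- (\<alpha> / k ^ d))\<close>; these multiply to
  exactly \<open>exp (- \<alpha>)\<close>.\<close>

lemma random_subset_coarsen:
  assumes k: "k > 0" and lam: "\<alpha> \<ge> 0"
  shows "map_pmf (image (coarsen d k)) (rand_edges d (k * n) (1 - exp (- (\<alpha> / real k ^ d)))) =
    rand_edges d n (1 - exp (- \<alpha>))"
proof (rule random_subset_map_eqI[where G = "\<lambda>T. {e \<in> complete_edges d (k * n). coarsen d k e \<in> T}"])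
  fix T assume T: "T \<subseteq> complete_edges d n"
  let ?A = "complete_edges d (k * n)" and ?B = "complete_edges d n"
  have "?A - {e \<in> ?A. coarsen d k e \<in> T} = (\<Union>f\<in>?B - T. {e \<in> ?A. coarsen d k e = f})"
    using coarsen_in[OF k] by auto
  then have "card (?A - {e \<in> ?A. coarsen d k e \<in> T}) = (\<Sum>f\<in>?B - T. card {e \<in> ?A. coarsen d k e = f})"
    by (simp only:) (subst card_UN_disjoint, auto)
  also have "\<dots> = (\<Sum>f\<in>?B - T. k ^ d)"
    by (intro sum.cong refl card_coarsen_fibre k) simp
  finally have card: "card (?A - {e \<in> ?A. coarsen d k e \<in> T}) = card (?B - T) * k ^ d" by simp
  show "(1 - (1 - exp (- (\<alpha> / real k ^ d)))) ^ card (?A - {e \<in> ?A. coarsen d k e \<in> T}) =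
    (1 - (1 - exp (- \<alpha>))) ^ card (?B - T)"
    unfolding card using k by (simp add: exp_of_nat_mult[symmetric])
qed (use lam coarsen_in[OF k] in auto)

text \<open>Labels in strictly increasing blocks are themselves strictly increasing, so a chain of
  blocks lifts to a chain of edges.\<close>

lemma max_noncrossing_coarsen_le:
  assumes "finite S"
  shows "max_noncrossing d (coarsen d k ` S) \<le> max_noncrossing d S"
proof -
  obtain M where M: "M \<subseteq> coarsen d k ` S" "strict_chain d M"
    "card M = max_noncrossing d (coarsen d k ` S)"
    using max_noncrossing_witness[of "coarsen d k ` S"] assms by blast
  have "x i < y i" if "i < d" "coarsen d k x i < coarsen d k y i" for x y :: "nat \<Rightarrow> nat" and i
  proof (rule ccontr)
    assume "\<not> x i < y i"
    then have "(y i - 1) div k \<le> (x i - 1) div k" by (intro div_le_mono) simp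
    then show False using that by (simp add: coarsen_def)
  qed
  then obtain N where "N \<subseteq> S" "strict_chain d N" "card N = card M"
    using strict_chain_pullback[OF M(1,2)] by metis
  then show ?thesis using max_noncrossing_ge[OF assms, of N] M by simp
qed

lemma expected_L_refine:
  assumes "k > 0" "\<alpha> \<ge> 0"
  shows "expected_L d (1 - exp (- \<alpha>)) n \<le> expected_L d (1 - exp (- (\<alpha> / real k ^ d))) (k * n)"
  unfolding expected_L_eq random_subset_coarsen[OF assms, symmetric] integral_map_pmf
  by (intro expectation_pmf_mono of_nat_mono max_noncrossing_coarsen_le finite_in_rand_edges)
    simp_all

section \<open>Laplace transform and exponential lower tail\<close>

lemma laplace_L_power:
  assumes d: "d > 0" and p: "0 \<le> p" "p \<le> 1" and s: "s \<ge> 0"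
  shows "measure_pmf.expectation (rand_edges d (k * n) p) (\<lambda>S. exp (- s * real (max_noncrossing d S)))
    \<le> measure_pmf.expectation (rand_edges d n p) (\<lambda>S. exp (- s * real (max_noncrossing d S))) ^ k"
proof (induction k)
  case 0
  have "measure_pmf.expectation (rand_edges d (0 * n) p) (\<lambda>S. exp (- s * real (max_noncrossing d S)))
     \<le> measure_pmf.expectation (rand_edges d (0 * n) p) (\<lambda>S. 1)"
    using s by (intro expectation_pmf_mono) auto
  then show ?case by simp
next
  case (Suc k)
  let ?E = "\<lambda>n f. measure_pmf.expectation (rand_edges d n p) (\<lambda>S. f (real (max_noncrossing d S)) :: real)"
  \<comment> \<open>The superadditivity lemma wants an increasing function of the matching size,
    hence the minus sign.\<close>
  have "mono (\<lambda>x. - exp (- s * real x))"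
    using s by (auto simp: mono_def intro!: mult_left_mono)
  from expectation_mono_superadditive[OF d p this, of n "k * n"]
  have "?E (n + k * n) (\<lambda>x. exp (- s * x)) \<le> ?E n (\<lambda>x. exp (- s * x)) * ?E (k * n) (\<lambda>x. exp (- s * x))"
    by (simp add: distrib_left exp_add exp_diff exp_minus divide_inverse)
  also have "\<dots> \<le> ?E n (\<lambda>x. exp (- s * x)) * ?E n (\<lambda>x. exp (- s * x)) ^ k"
    by (intro mult_left_mono Suc.IH integral_nonneg_AE) auto
  finally show ?case by (simp add: algebra_simps)
qed

text \<open>Multiplying the right side by \<open>1 + x\<close> gives \<open>1 + x^3\<close>, which
  is at least 1, and \<open>1 + x \<le> exp x\<close>.\<close>

lemma exp_minus_le_quadratic:
  fixes x :: real
  assumes "x \<ge> 0"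
  shows "exp (- x) \<le> 1 - x + x\<^sup>2"
proof -
  have "1 \<le> 1 + x * x\<^sup>2" using assms by simp
  also have "\<dots> = (1 - x + x\<^sup>2) * (1 + x)" by (simp add: algebra_simps power2_eq_square)
  also have "\<dots> \<le> (1 - x + x\<^sup>2) * exp x"
  proof (rule mult_left_mono)
    have "1 - x + x\<^sup>2 = (x - 1/2)\<^sup>2 + 3/4" by (simp add: power2_eq_square algebra_simps)
    then show "0 \<le> 1 - x + x\<^sup>2" by simp
  qed (rule exp_ge_add_one_self)
  finally show ?thesis by (simp add: exp_minus divide_simps)
qed

text \<open>A Chernoff bound for \<open>k\<close> independent diagonal blocks of side
  \<open>n\<close>, each with mean above \<open>a\<close>. Sizes in one block lie between 0 and
  \<open>n\<close>, so the quadratic bound controls its Laplace transform.\<close>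

lemma lower_tail_L:
  assumes d: "d > 0" and p: "0 \<le> p" "p \<le> 1" and n: "n > 0" and a: "a < expected_L d p n"
  shows "(\<lambda>k. measure_pmf.prob (rand_edges d (k * n) p) {S. real (max_noncrossing d S) \<le> real k * a})
    \<longlonglongrightarrow> 0"
proof -
  define m where "m = expected_L d p n"
  \<comment> \<open>This \<open>s\<close> minimises the exponent
    \<open>s * a - s * m + s^2 * n^2\<close>, and \<open>- \<gamma>\<close> is the minimal
    value.\<close>
  define s where "s = (m - a) / (2 * (real n)\<^sup>2)"
  define \<gamma> where "\<gamma> = (m - a)\<^sup>2 / (4 * (real n)\<^sup>2)"
  have s: "s > 0" and \<gamma>: "\<gamma> > 0" using a n by (auto simp: s_def \<gamma>_def m_def)
  let ?L = "\<lambda>S. real (max_noncrossing d S)"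
  let ?E = "\<lambda>n f. measure_pmf.expectation (rand_edges d n p) (\<lambda>S. f (?L S) :: real)"
  have "?E n (\<lambda>x. exp (- s * x)) \<le> ?E n (\<lambda>x. 1 - s * x + s\<^sup>2 * (real n)\<^sup>2)"
  proof (intro expectation_pmf_mono)
    fix S assume "S \<in> set_pmf (rand_edges d n p)"
    then have "?L S \<le> n" by (intro of_nat_mono max_noncrossing_le[OF d] set_rand_edges)
    then have "(s * ?L S)\<^sup>2 \<le> s\<^sup>2 * (real n)\<^sup>2"
      using s by (simp add: power_mult_distrib power_mono)
    with exp_minus_le_quadratic[of "s * ?L S"] s
    show "exp (- s * ?L S) \<le> 1 - s * ?L S + s\<^sup>2 * (real n)\<^sup>2" by simp
  qed simp
  also have "\<dots> = 1 - s * m + s\<^sup>2 * (real n)\<^sup>2"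
    by (simp add: m_def expected_L_eq)
  also have "\<dots> \<le> exp (- s * m + s\<^sup>2 * (real n)\<^sup>2)"
    using exp_ge_add_one_self[of "- s * m + s\<^sup>2 * (real n)\<^sup>2"] by (simp add: algebra_simps)
  finally have le: "?E n (\<lambda>x. exp (- s * x)) \<le> exp (- s * m + s\<^sup>2 * (real n)\<^sup>2)" .
  have exponent: "s * a + (- s * m + s\<^sup>2 * (real n)\<^sup>2) = - \<gamma>"
    using n by (simp add: s_def \<gamma>_def field_simps power2_eq_square)
  have bound: "measure_pmf.prob (rand_edges d (k * n) p) {S. ?L S \<le> real k * a} \<le> exp (- \<gamma>) ^ k" for k
  proof -
    have "measure_pmf.prob (rand_edges d (k * n) p) {S. ?L S \<le> real k * a}
        = measure_pmf.expectation (rand_edges d (k * n) p) (indicator {S. ?L S \<le> real k * a})"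
      by simp
    also have "\<dots> \<le> ?E (k * n) (\<lambda>x. exp (s * a) ^ k * exp (- s * x))"
    proof (intro expectation_pmf_mono)
      fix S :: "(nat \<Rightarrow> nat) set"
      have "exp (s * a) ^ k * exp (- s * ?L S) = exp (s * (real k * a - ?L S))"
        by (simp add: exp_of_nat_mult[symmetric] exp_add[symmetric] algebra_simps)
      moreover have "1 \<le> exp (s * (real k * a - ?L S))" if "?L S \<le> real k * a"
        using that s by simp
      ultimately show "indicator {S. ?L S \<le> real k * a} S \<le> exp (s * a) ^ k * exp (- s * ?L S)"
        by (auto simp: indicator_def)
    qed simp
    also have "\<dots> = exp (s * a) ^ k * ?E (k * n) (\<lambda>x. exp (- s * x))" by simp
    also have "\<dots> \<le> exp (s * a) ^ k * ?E n (\<lambda>x. exp (- s * x)) ^ k"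
      by (intro mult_left_mono laplace_L_power d p) (use s in auto)
    also have "\<dots> \<le> exp (s * a) ^ k * exp (- s * m + s\<^sup>2 * (real n)\<^sup>2) ^ k"
      by (intro mult_left_mono power_mono le integral_nonneg_AE) auto
    also have "\<dots> = exp (- \<gamma>) ^ k"
      by (simp add: power_mult_distrib[symmetric] exp_add[symmetric] exponent[symmetric] del: exp_of_nat_mult)
    finally show ?thesis .
  qed
  have "(\<lambda>k. exp (- \<gamma>) ^ k) \<longlonglongrightarrow> 0"
    using \<gamma> by (intro LIMSEQ_realpow_zero) auto
  then show ?thesis
    by (rule tendsto_sandwich[OF _ _ tendsto_const, rotated 2]) (auto intro!: always_eventually bound)
qed

subsection \<open>The first moment bound and the limit constant\<close>

text \<open>Union bound over the strict chains with exactly \<open>k\<close> members; a longer chain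
  contains one of these.\<close>

lemma prob_L_ge:
  assumes d: "d > 0" and p: "0 \<le> p" "p \<le> 1"
  shows "measure_pmf.prob (rand_edges d n p) {S. k \<le> max_noncrossing d S} \<le> real ((n choose k) ^ d) * p ^ k"
proof -
  define C where "C = {M. M \<subseteq> complete_edges d n \<and> strict_chain d M \<and> card M = k}"
  have finC: "finite C"
    by (rule finite_subset[of _ "Pow (complete_edges d n)"]) (auto simp: C_def)
  have "\<exists>M\<in>C. M \<subseteq> S" if S: "S \<in> set_pmf (rand_edges d n p)" "k \<le> max_noncrossing d S" for S
  proof -
    obtain M where M: "M \<subseteq> S" "strict_chain d M" "card M = max_noncrossing d S"
      using max_noncrossing_witness[OF finite_in_rand_edges[OF S(1)]] by metis
    then obtain N where N: "N \<subseteq> M" "card N = k"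
      using S(2) obtain_subset_with_card_n[of k M] by metis
    then have "strict_chain d N" using M(2) by (auto simp: strict_chain_def)
    then have "N \<in> C" using N M set_rand_edges[OF S(1)] by (auto simp: C_def)
    then show ?thesis using N M by blast
  qed
  then have "measure_pmf.prob (rand_edges d n p) {S. k \<le> max_noncrossing d S}
      \<le> measure_pmf.prob (rand_edges d n p) (\<Union>M\<in>C. {S. M \<subseteq> S})"
    by (intro measure_pmf.finite_measure_mono_AE) (auto simp: AE_measure_pmf_iff)
  also have "\<dots> \<le> (\<Sum>M\<in>C. measure_pmf.prob (rand_edges d n p) {S. M \<subseteq> S})"
    by (intro measure_pmf.finite_measure_subadditive_finite finC) auto
  also have "\<dots> = (\<Sum>M\<in>C. p ^ k)"
    using p by (intro sum.cong refl) (auto simp: C_def prob_superset_random_subset)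
  also have "\<dots> \<le> real ((n choose k) ^ d) * p ^ k"
    using card_strict_chains_le[OF d, of n k] p
    by (simp add: C_def mult_right_mono del: of_nat_power)
  finally show ?thesis .
qed

text \<open>The Poisson distribution with mean \<open>k\<close> gives the point \<open>k\<close> a
  mass of at most 1.\<close>

lemma power_self_le_exp_fact: "real k ^ k \<le> exp (real k) * fact k"
proof (cases "k = 0")
  case False
  have "pmf (poisson_pmf (real k)) k \<le> 1" by (rule pmf_le_1)
  with False show ?thesis by (simp add: exp_minus field_simps)
qed simp

text \<open>With \<open>q = p powr (1/d)\<close>, the union bound is the \<open>d\<close>-th power
  of \<open>(n choose k) * q ^ k\<close>, which is at most \<open>(exp 1 * n * q / k) ^ k\<close>.
  The assumption on \<open>k\<close> makes the base at most 1/2. When the size reaches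
  \<open>k\<close>, it is bounded by \<open>n\<close>.\<close>

lemma expected_L_le_threshold:
  assumes d: "d > 0" and p: "0 < p" "p \<le> 1" and k: "k > 0"
    and kn: "2 * exp 1 * p powr (1 / real d) * real n \<le> real k"
  shows "expected_L d p n \<le> real k + real n * (1 / 2) ^ k"
proof -
  define q where "q = p powr (1 / real d)"
  have q: "q > 0" "q ^ d = p" using p d by (auto simp: q_def powr_realpow[symmetric] powr_powr)
  have "real (n choose k) * fact k \<le> real n ^ k"
    using binomial_fact_pow[of n k] by (metis of_nat_le_iff of_nat_mult of_nat_power of_nat_fact)
  then have "real (n choose k) * real k ^ k \<le> real (n choose k) * (exp (real k) * fact k)"
    by (intro mult_left_mono power_self_le_exp_fact) simp
  also have "\<dots> = exp (real k) * (real (n choose k) * fact k)" by simp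
  also have "\<dots> \<le> exp (real k) * real n ^ k"
    by (intro mult_left_mono) (fact, simp)
  also have "\<dots> = (exp 1 * real n) ^ k"
    by (simp add: power_mult_distrib exp_of_nat_mult[symmetric])
  finally have "real (n choose k) \<le> (exp 1 * real n / real k) ^ k"
    using k by (simp add: power_divide field_simps)
  then have "real (n choose k) * q ^ k \<le> (exp 1 * real n / real k) ^ k * q ^ k"
    using q by (intro mult_right_mono) auto
  also have "\<dots> = (exp 1 * real n * q / real k) ^ k" by (simp add: power_mult_distrib[symmetric])
  also have "\<dots> \<le> (1 / 2) ^ k"
    using kn k q by (intro power_mono) (auto simp: q_def[symmetric] field_simps)
  finally have *: "real (n choose k) * q ^ k \<le> (1 / 2) ^ k" .
  have "real ((n choose k) ^ d) * p ^ k = (real (n choose k) * q ^ k) ^ d"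
    using q(2) by (simp add: power_mult_distrib power_mult[symmetric] mult.commute[of d k] flip: q(2))
  also have "\<dots> \<le> ((1 / 2) ^ k) ^ d" using * q by (intro power_mono) auto
  also have "\<dots> \<le> ((1 / 2) ^ k) ^ 1" using d by (intro power_decreasing) (auto simp: power_le_one)
  finally have prob: "measure_pmf.prob (rand_edges d n p) {S. k \<le> max_noncrossing d S} \<le> (1 / 2) ^ k"
    using prob_L_ge[OF d, of p n k] p by simp
  have "expected_L d p n \<le> measure_pmf.expectation (rand_edges d n p)
      (\<lambda>S. real k + real n * indicator {S. k \<le> max_noncrossing d S} S)"
    unfolding expected_L_eq
  proof (rule expectation_pmf_mono)
    fix S assume "S \<in> set_pmf (rand_edges d n p)"
    then have "max_noncrossing d S \<le> n" by (intro max_noncrossing_le[OF d] set_rand_edges)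
    then show "real (max_noncrossing d S) \<le> real k + real n * indicator {S. k \<le> max_noncrossing d S} S"
      by (auto simp: indicator_def)
  qed simp
  also have "\<dots> = real k + real n * measure_pmf.prob (rand_edges d n p) {S. k \<le> max_noncrossing d S}"
    by simp
  also have "\<dots> \<le> real k + real n * (1 / 2) ^ k"
    using prob by (intro add_left_mono mult_left_mono) auto
  finally show ?thesis .
qed

text \<open>The threshold bound has an additive error. Superadditivity removes it: applied at side
  \<open>j * n\<close> it gives \<open>j * expected_L d p n \<le> x * j * n + 1 + 1 / x\<close>, and
  after division by \<open>j\<close> the error vanishes as \<open>j\<close> grows.\<close>

lemma expected_L_le_powr:
  assumes d: "d > 0" and p: "0 < p" "p \<le> 1"
  shows "expected_L d p n \<le> 2 * exp 1 * p powr (1 / real d) * real n"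
proof (cases "n = 0")
  case True then show ?thesis using expected_L_le[OF d, of p n] by simp
next
  case False
  define x where "x = 2 * exp 1 * p powr (1 / real d)"
  have x: "x > 0" using p by (simp add: x_def)
  have "expected_L d p n \<le> x * real n + (1 + 1 / x) * inverse (real j)" if j: "j > 0" for j
  proof -
    define k where "k = nat \<lceil>x * real (j * n)\<rceil>"
    have xj: "x * real (j * n) > 0" using x j False by simp
    have k: "x * real (j * n) \<le> real k" "real k \<le> x * real (j * n) + 1"
      using xj unfolding k_def by linarith+
    then have "k > 0" using xj by linarith
    \<comment> \<open>The crude estimate \<open>2 ^ (-k) \<le> 1 / k\<close> suffices: since
      \<open>k\<close> is at least \<open>x * j * n\<close>, the second error term is at most
      \<open>1 / x\<close>, uniformly in \<open>j\<close>.\<close>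
    have "real k < 2 ^ k" using of_nat_less_two_power[of k, where 'a = real] .
    then have "(1 / 2) ^ k \<le> 1 / real k"
      using \<open>k > 0\<close> by (simp add: power_divide field_simps)
    also have "\<dots> \<le> 1 / (x * real (j * n))" using k(1) xj by (intro divide_left_mono) auto
    finally have half: "real (j * n) * (1 / 2) ^ k \<le> real (j * n) * (1 / (x * real (j * n)))"
      by (intro mult_left_mono) auto
    have "real j * expected_L d p n \<le> expected_L d p (j * n)"
      using p by (intro expected_L_mult_le d) auto
    also have "\<dots> \<le> real k + real (j * n) * (1 / 2) ^ k"
      using k(1) \<open>k > 0\<close> by (intro expected_L_le_threshold d p) (auto simp: x_def mult_ac)
    also have "\<dots> \<le> x * real (j * n) + 1 + 1 / x" using k(2) half j False by simp
    finally have "real j * expected_L d p n \<le> real j * (x * real n + (1 + 1 / x) * inverse (real j))"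
      using j by (simp add: algebra_simps)
    then show ?thesis using j by simp
  qed
  moreover have "(\<lambda>j. x * real n + (1 + 1 / x) * inverse (real j)) \<longlonglongrightarrow> x * real n + (1 + 1 / x) * 0"
    by (intro tendsto_intros lim_inverse_n)
  ultimately have "expected_L d p n \<le> x * real n + (1 + 1 / x) * 0"
    by (intro LIMSEQ_le_const[where X = "\<lambda>j. x * real n + (1 + 1 / x) * inverse (real j)"]) (auto intro!: exI[of _ 1])
  then show ?thesis by (simp add: x_def)
qed

section \<open>Fekete's lemma and the limit constant\<close>

lemma superadditive_tendsto_SUP:
  fixes a :: "nat \<Rightarrow> real"
  assumes super: "\<And>m n. a m + a n \<le> a (m + n)" and nonneg: "\<And>n. 0 \<le> a n"
    and bound: "\<And>n. a n \<le> C * real n"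
  shows "(\<lambda>n. a n / real n) \<longlonglongrightarrow> (SUP n\<in>{1..}. a n / real n)"
proof (rule order_tendstoI)
  have bdd: "bdd_above ((\<lambda>n. a n / real n) ` {1..})"
    using bound by (intro bdd_aboveI[of _ C]) (auto simp: field_simps)
  have mult: "real q * a k \<le> a (q * k)" for q k
  proof (induction q)
    case 0 then show ?case by (simp add: nonneg)
  next
    case (Suc q) then show ?case using super[of k "q * k"] by (simp add: algebra_simps)
  qed
  fix y
  {
    assume "y < (SUP n\<in>{1..}. a n / real n)"
    then obtain k where k: "k \<ge> 1" "y < a k / real k"
      using less_cSUP_iff[OF _ bdd, of y] by auto
    have "(\<lambda>n. a k / real k - a k * inverse (real n)) \<longlonglongrightarrow> a k / real k - a k * 0"
      by (intro tendsto_intros lim_inverse_n)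
    then have "\<forall>\<^sub>F n in sequentially. y < a k / real k - a k * inverse (real n)"
      using k by (intro order_tendstoD) auto
    then show "\<forall>\<^sub>F n in sequentially. y < a n / real n"
      using eventually_gt_at_top[of 0]
    proof eventually_elim
      case (elim n)
      \<comment> \<open>Here \<open>n\<close> is cut into \<open>n div k\<close> pieces of length
        \<open>k\<close> and a remainder. Nonnegativity of \<open>a\<close> lets the remainder be
        dropped, at a relative cost of at most \<open>a k / n\<close>.\<close>
      have "real n / real k - 1 \<le> real (n div k)"
      proof -
        have "n < Suc (n div k) * k" using k dividend_less_times_div[of k n] by (simp add: mult.commute)
        then have "real n < real (Suc (n div k)) * real k" by (metis of_nat_less_iff of_nat_mult)
        then show ?thesis using k by (simp add: field_simps)
      qed
      then have "(real n / real k - 1) * a k \<le> real (n div k) * a k"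
        by (intro mult_right_mono nonneg)
      also have "\<dots> \<le> a (n div k * k)" by (rule mult)
      also have "\<dots> \<le> a (n div k * k) + a (n mod k)" using nonneg by simp
      also have "\<dots> \<le> a n" using super[of "n div k * k" "n mod k"] by simp
      finally have "(real n / real k - 1) * a k / real n \<le> a n / real n"
        by (intro divide_right_mono) auto
      moreover have "(real n / real k - 1) * a k / real n = a k / real k - a k * inverse (real n)"
        using elim k by (simp add: field_simps)
      ultimately show ?case using elim by simp
    qed
  }
  {
    assume y: "(SUP n\<in>{1..}. a n / real n) < y"
    show "\<forall>\<^sub>F n in sequentially. a n / real n < y"
      using eventually_ge_at_top[of 1]
    proof eventually_elim
      case (elim n)
      have "a n / real n \<le> (SUP n\<in>{1..}. a n / real n)"
        using elim by (intro cSUP_upper bdd) auto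
      with y show ?case by simp
    qed
  }
qed

text \<open>\<open>fst z\<close> is the mean number of points per cell of a Poisson process, \<open>snd z\<close> the side of the grid.\<close>

definition chain_const :: "nat \<Rightarrow> real" where
  "chain_const d = (SUP z\<in>{0<..} \<times> {1..}.
     expected_L d (1 - exp (- fst z)) (snd z) / (real (snd z) * fst z powr (1 / real d)))"

lemma one_minus_exp_bounds:
  fixes x :: real
  assumes "x > 0"
  shows "0 < 1 - exp (- x)" "1 - exp (- x) \<le> 1" "1 - exp (- x) \<le> x"
  using assms exp_ge_add_one_self[of "- x"] by auto

text \<open>Without this bound the real supremum in \<open>chain_const\<close> would carry no
  information. It is uniform in the intensity because \<open>1 - exp (- x) \<le> x\<close>.\<close>

lemma bdd_above_chain_const:
  assumes d: "d > 0"
  shows "bdd_above ((\<lambda>z. expected_L d (1 - exp (- fst z)) (snd z) / (real (snd z) * fst z powr (1 / real d)))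
    ` ({0<..} \<times> {1..}))"
proof (rule bdd_aboveI2)
  fix z :: "real \<times> nat" assume z: "z \<in> {0<..} \<times> {1..}"
  obtain x n where [simp]: "z = (x, n)" by (cases z)
  have x: "x > 0" and n: "n \<ge> 1" using z by auto
  note b = one_minus_exp_bounds[OF x]
  have "expected_L d (1 - exp (- x)) n \<le> 2 * exp 1 * (1 - exp (- x)) powr (1 / real d) * real n"
    by (rule expected_L_le_powr[OF d b(1,2)])
  also have "\<dots> \<le> 2 * exp 1 * x powr (1 / real d) * real n"
    using b x by (intro mult_right_mono mult_left_mono powr_mono2) auto
  finally show "expected_L d (1 - exp (- fst z)) (snd z) / (real (snd z) * fst z powr (1 / real d)) \<le> 2 * exp 1"
    using x n by (simp add: field_simps)
qed

lemma expected_L_le_chain_const: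
  assumes d: "d > 0" and x: "x > 0"
  shows "expected_L d (1 - exp (- x)) n \<le> chain_const d * (real n * x powr (1 / real d))"
proof (cases "n = 0")
  case True then show ?thesis using expected_L_le[OF d, of _ n] by simp
next
  case False
  have "expected_L d (1 - exp (- x)) n / (real n * x powr (1 / real d)) \<le> chain_const d"
    unfolding chain_const_def
    using cSUP_upper[OF _ bdd_above_chain_const[OF d], of "(x, n)"] x False by auto
  then show ?thesis using x False by (simp add: divide_le_eq)
qed

lemma chain_const_approx:
  assumes d: "d > 0" and a: "a < chain_const d"
  obtains x n where "x > 0" "n > 0" "a * (real n * x powr (1 / real d)) < expected_L d (1 - exp (- x)) n"
proof -
  obtain z where z: "z \<in> {0<..} \<times> {1..}"
    "a < expected_L d (1 - exp (- fst z)) (snd z) / (real (snd z) * fst z powr (1 / real d))"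
    using a less_cSUP_iff[OF _ bdd_above_chain_const[OF d], of a] unfolding chain_const_def
    by (metis (no_types, lifting) SigmaI atLeast_iff empty_iff greaterThan_iff order_refl zero_less_one)
  show ?thesis
    using z by (intro that[of "fst z" "snd z"]) (auto simp: less_divide_eq)
qed

lemma chain_const_nonneg:
  assumes "d > 0"
  shows "0 \<le> chain_const d"
proof -
  have "0 \<le> expected_L d (1 - exp (- 1)) 1" by (rule expected_L_nonneg)
  also have "\<dots> \<le> chain_const d * (real 1 * 1 powr (1 / real d))"
    by (rule expected_L_le_chain_const[OF assms]) simp
  finally show ?thesis by simp
qed

text \<open>A good value at intensity \<open>x\<close> is carried to intensity \<open>y\<close> by
  cutting each cell into \<open>k ^ d\<close> cells, where \<open>k\<close> is the least integer
  with \<open>x / k ^ d \<le> y\<close>, so \<open>N = k * n\<close>. Rounding \<open>k\<close> up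
  costs the factor \<open>x powr (1/d) / (x powr (1/d) + y powr (1/d))\<close>, which tends to 1 as
  \<open>y\<close> tends to 0.\<close>

lemma expected_L_rescaled_lower:
  assumes d: "d > 0" and x: "x > 0" and n: "n > 0" and a: "a \<ge> 0" and y: "y > 0"
    and E: "a * (real n * x powr (1 / real d)) < expected_L d (1 - exp (- x)) n"
  obtains N where "N > 0"
    "a * x powr (1 / real d) / (x powr (1 / real d) + y powr (1 / real d)) * y powr (1 / real d)
      \<le> expected_L d (1 - exp (- y)) N / real N"
proof -
  let ?r = "\<lambda>z. z powr (1 / real d)"
  define k where "k = nat \<lceil>?r (x / y)\<rceil>"
  have pos: "?r (x / y) > 0" "?r x > 0" "?r y > 0" using x y by auto
  have k: "?r (x / y) \<le> real k" "real k \<le> ?r (x / y) + 1" using pos(1) unfolding k_def by linarith+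
  have "k > 0" using k(1) pos(1) by linarith
  have "x / y = ?r (x / y) ^ d" using x y d by (simp add: powr_realpow[symmetric] powr_powr)
  also have "\<dots> \<le> real k ^ d" using k(1) by (intro power_mono) auto
  finally have xy: "x / real k ^ d \<le> y" using y \<open>k > 0\<close> by (simp add: field_simps)
  have "a * (real n * ?r x) \<le> expected_L d (1 - exp (- x)) n" using E by simp
  also have "\<dots> \<le> expected_L d (1 - exp (- (x / real k ^ d))) (k * n)"
    using x \<open>k > 0\<close> by (intro expected_L_refine) auto
  also have "\<dots> \<le> expected_L d (1 - exp (- y)) (k * n)"
    using x \<open>k > 0\<close> xy by (intro expected_L_mono_p) auto
  finally have "a * (real n * ?r x) / real (k * n) \<le> expected_L d (1 - exp (- y)) (k * n) / real (k * n)"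
    by (intro divide_right_mono) auto
  moreover have "a * ?r x / (?r x + ?r y) * ?r y \<le> a * (real n * ?r x) / real (k * n)"
  proof -
    have "real k * ?r y \<le> ?r x + ?r y"
    proof -
      have "real k * ?r y \<le> (?r (x / y) + 1) * ?r y" using k(2) pos by (intro mult_right_mono) auto
      also have "?r (x / y) = ?r x / ?r y" using x y by (simp add: powr_divide)
      also have "(?r x / ?r y + 1) * ?r y = ?r x + ?r y" using pos by (simp add: field_simps)
      finally show ?thesis .
    qed
    then have "a * ?r x * (real k * ?r y) \<le> a * ?r x * (?r x + ?r y)"
      using a pos by (intro mult_left_mono) auto
    then have "a * ?r x * (real k * ?r y) / (real k * (?r x + ?r y))
        \<le> a * ?r x * (?r x + ?r y) / (real k * (?r x + ?r y))"
      using pos by (intro divide_right_mono) auto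
    moreover have "?r x + ?r y \<noteq> 0" using pos by linarith
    ultimately have "a * ?r x / (?r x + ?r y) * ?r y \<le> a * ?r x / real k"
      using \<open>k > 0\<close> by simp
    also have "\<dots> = a * (real n * ?r x) / real (k * n)" using n by simp
    finally show ?thesis .
  qed
  ultimately show ?thesis using that[of "k * n"] n \<open>k > 0\<close> by simp
qed

lemma expected_L_tendsto_SUP:
  assumes "d > 0" "0 \<le> p" "p \<le> 1"
  shows "(\<lambda>n. expected_L d p n / real n) \<longlonglongrightarrow> (SUP n\<in>{1..}. expected_L d p n / real n)"
  using assms by (intro superadditive_tendsto_SUP[where C = 1])
    (auto intro: expected_L_superadditive expected_L_nonneg expected_L_le)

lemma SUP_expected_L_asymp:
  assumes d: "d > 0"
  shows "((\<lambda>p. (SUP n\<in>{1..}. expected_L d p n / real n) / p powr (1 / real d)) \<longlongrightarrow> chain_const d) (at_right 0)"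
proof -
  let ?D = "\<lambda>p. SUP n\<in>{1..}. expected_L d p n / real n"
  let ?r = "\<lambda>z. z powr (1 / real d)"
  \<comment> \<open>The Poisson intensity that belongs to edge probability \<open>p\<close>. As
    \<open>\<alpha> p / p\<close> tends to 1, normalising by \<open>p\<close> or by
    \<open>\<alpha> p\<close> gives the same limit.\<close>
  define \<alpha> where "\<alpha> p = - ln (1 - p)" for p :: real
  have bdd: "bdd_above ((\<lambda>n. expected_L d p n / real n) ` {1..})" for p
    using expected_L_le[OF d] by (intro bdd_aboveI[of _ 1]) (auto simp: field_simps)
  have \<alpha>: "\<alpha> p > 0" "1 - exp (- \<alpha> p) = p" "p \<le> \<alpha> p" if "0 < p" "p < 1" for p
  proof -
    show "1 - exp (- \<alpha> p) = p" using that by (simp add: \<alpha>_def)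
    show "p \<le> \<alpha> p" using ln_add_one_self_le_self2[of "- p"] that by (simp add: \<alpha>_def)
    then show "\<alpha> p > 0" using that by simp
  qed
  have small: "\<forall>\<^sub>F p::real in at_right 0. 0 < p \<and> p < 1"
    by (auto simp: eventually_at_right_field intro!: exI[of _ 1])
  have lim\<alpha>: "((\<lambda>p. \<alpha> p / p) \<longlongrightarrow> 1) (at_right 0)" unfolding \<alpha>_def by real_asymp
  have lim\<alpha>0: "(\<alpha> \<longlongrightarrow> 0) (at_right 0)" unfolding \<alpha>_def by real_asymp
  show ?thesis
  proof (rule order_tendstoI)
    fix b assume b: "b < chain_const d"
    show "\<forall>\<^sub>F p in at_right 0. b < ?D p / ?r p"
    \<comment> \<open>Rescaling needs a nonnegative \<open>a\<close>; for negative \<open>b\<close>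
      the claim follows from nonnegativity of the quotient.\<close>
    proof (cases "b < 0")
      case True
      show ?thesis
        using small
      proof eventually_elim
        case (elim p)
        have "0 \<le> expected_L d p 1 / real 1" by (simp add: expected_L_nonneg)
        also have "\<dots> \<le> ?D p" by (rule cSUP_upper[OF _ bdd]) simp
        finally have "0 \<le> ?D p / ?r p" by simp
        with True show ?case by linarith
      qed
    next
      case False
      define a where "a = (b + chain_const d) / 2"
      have a: "b < a" "a < chain_const d" "a \<ge> 0" using b False by (auto simp: a_def)
      obtain x n where xn: "x > 0" "n > 0" "a * (real n * ?r x) < expected_L d (1 - exp (- x)) n"
        using chain_const_approx[OF d a(2)] .
      have "((\<lambda>p. ?r (\<alpha> p)) \<longlongrightarrow> 0) (at_right 0)"
      proof (rule tendsto_zero_powrI[OF lim\<alpha>0 tendsto_const])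
        show "\<forall>\<^sub>F p in at_right 0. 0 \<le> \<alpha> p" using small by eventually_elim (use \<alpha> in force)
      qed (use d in simp)
      then have "((\<lambda>p. a * ?r x / (?r x + ?r (\<alpha> p))) \<longlongrightarrow> a * ?r x / (?r x + 0)) (at_right 0)"
        using xn by (intro tendsto_intros) auto
      then have "\<forall>\<^sub>F p in at_right 0. b < a * ?r x / (?r x + ?r (\<alpha> p))"
        using a xn by (intro order_tendstoD) auto
      with small show ?thesis
      proof eventually_elim
        case (elim p)
        then have p: "0 < p" "p < 1" by auto
        note al = \<alpha>[OF p]
        obtain N where N: "N > 0" "a * ?r x / (?r x + ?r (\<alpha> p)) * ?r (\<alpha> p) \<le> expected_L d p N / real N"
          using expected_L_rescaled_lower[OF d xn(1,2) a(3) al(1) xn(3)] al(2) by metis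
        have "b * ?r p \<le> b * ?r (\<alpha> p)"
          using False al p by (intro mult_left_mono powr_mono2) auto
        also have "\<dots> < a * ?r x / (?r x + ?r (\<alpha> p)) * ?r (\<alpha> p)"
          using elim al by (intro mult_strict_right_mono) auto
        also have "\<dots> \<le> expected_L d p N / real N" by (rule N)
        also have "\<dots> \<le> ?D p" using N by (intro cSUP_upper bdd) auto
        finally show ?case using p by (simp add: less_divide_eq)
      qed
    qed
  next
    fix b assume b: "chain_const d < b"
    have "((\<lambda>p. chain_const d * ?r (\<alpha> p / p)) \<longlongrightarrow> chain_const d * ?r 1) (at_right 0)"
      by (intro tendsto_intros lim\<alpha>) auto
    then have "\<forall>\<^sub>F p in at_right 0. chain_const d * ?r (\<alpha> p / p) < b"
      using b by (intro order_tendstoD) auto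
    with small show "\<forall>\<^sub>F p in at_right 0. ?D p / ?r p < b"
    proof eventually_elim
      case (elim p)
      then have p: "0 < p" "p < 1" by auto
      note al = \<alpha>[OF p]
      have "?D p \<le> chain_const d * ?r (\<alpha> p)"
      proof (rule cSUP_least)
        fix n :: nat assume n: "n \<in> {1..}"
        show "expected_L d p n / real n \<le> chain_const d * ?r (\<alpha> p)"
          using expected_L_le_chain_const[OF d al(1), of n] n unfolding al(2) by (simp add: field_simps)
      qed simp
      then have "?D p / ?r p \<le> chain_const d * ?r (\<alpha> p) / ?r p"
        by (intro divide_right_mono) auto
      also have "\<dots> = chain_const d * ?r (\<alpha> p / p)" using p al by (simp add: powr_divide)
      finally show ?case using elim by simp
    qed
  qed
qed

subsection \<open>Poisson occupancy\<close>

lemma measure_bind_pmf_eq_expectation: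
  "measure_pmf.prob (bind_pmf M f) X = measure_pmf.expectation M (\<lambda>x. measure_pmf.prob (f x) X)"
proof -
  have "ennreal (measure_pmf.prob (bind_pmf M f) X) = (\<integral>\<^sup>+x. ennreal (measure_pmf.prob (f x) X) \<partial>M)"
    using emeasure_bind_pmf[of M f X] by (simp add: measure_pmf.emeasure_eq_measure)
  also have "\<dots> = ennreal (measure_pmf.expectation M (\<lambda>x. measure_pmf.prob (f x) X))"
    by (intro nn_integral_eq_integral measure_pmf.integrable_const_bound[of _ 1]) auto
  finally show ?thesis by (simp add: integral_nonneg_AE)
qed

lemma expectation_bind_pmf_finite:
  fixes h :: "'b \<Rightarrow> real"
  assumes B: "finite B" and sub: "\<And>x. set_pmf (f x) \<subseteq> B"
  shows "measure_pmf.expectation (bind_pmf M f) h =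
      measure_pmf.expectation M (\<lambda>x. measure_pmf.expectation (f x) h)" (is ?eq)
    and "integrable (measure_pmf M) (\<lambda>x. measure_pmf.expectation (f x) h)" (is ?int)
proof -
  have E: "measure_pmf.expectation (f x) h = (\<Sum>b\<in>B. h b * pmf (f x) b)" for x
    using sub[of x] by (intro integral_measure_pmf_real B) auto
  have int: "integrable (measure_pmf M) (\<lambda>x. h b * pmf (f x) b)" for b
    by (intro integrable_mult_right measure_pmf.integrable_const_bound[of _ 1])
      (auto simp: pmf_le_1)
  show ?int unfolding E by (intro Bochner_Integration.integrable_sum int)
  have "measure_pmf.expectation (bind_pmf M f) h = (\<Sum>b\<in>B. h b * pmf (bind_pmf M f) b)"
    using sub by (intro integral_measure_pmf_real B) auto
  also have "\<dots> = (\<Sum>b\<in>B. measure_pmf.expectation M (\<lambda>x. h b * pmf (f x) b))"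
    by (simp add: pmf_bind)
  also have "\<dots> = measure_pmf.expectation M (\<lambda>x. \<Sum>b\<in>B. h b * pmf (f x) b)"
    by (rule Bochner_Integration.integral_sum[symmetric]) (rule int)
  finally show ?eq by (simp only: E)
qed

text \<open>The occupancy law of \<open>k\<close> independent uniform draws from \<open>A\<close>.
  Only the set of hit cells is kept, not the multiplicities, since this is all that
  \<open>max_noncrossing\<close> sees.\<close>

primrec occupied :: "'a set \<Rightarrow> nat \<Rightarrow> 'a set pmf" where
  "occupied A 0 = return_pmf {}"
| "occupied A (Suc k) = bind_pmf (occupied A k) (\<lambda>S. map_pmf (\<lambda>e. insert e S) (pmf_of_set A))"

lemma set_occupied:
  assumes "finite A" "A \<noteq> {}"
  shows "set_pmf (occupied A k) \<subseteq> Pow A"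
  by (induction k) (use assms in \<open>auto simp: set_pmf_of_set\<close>)

lemma finite_set_occupied: "finite A \<Longrightarrow> A \<noteq> {} \<Longrightarrow> finite (set_pmf (occupied A k))"
  using set_occupied finite_subset by (metis finite_Pow_iff)

lemma prob_occupied_subset:
  assumes A: "finite A" "A \<noteq> {}" and T: "T \<subseteq> A"
  shows "measure_pmf.prob (occupied A k) {S. S \<subseteq> T} = (real (card T) / real (card A)) ^ k"
proof (induction k)
  case (Suc k)
  have "measure_pmf.prob (map_pmf (\<lambda>e. insert e S) (pmf_of_set A)) {S. S \<subseteq> T}
      = real (card T) / real (card A) * indicator {S. S \<subseteq> T} S" for S
  proof -
    have "measure_pmf.prob (map_pmf (\<lambda>e. insert e S) (pmf_of_set A)) {S. S \<subseteq> T}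
       = measure_pmf.prob (pmf_of_set A) {e. e \<in> T \<and> S \<subseteq> T}"
      by (auto intro!: arg_cong[where f = "measure_pmf.prob _"])
    also have "\<dots> = real (card (A \<inter> {e. e \<in> T \<and> S \<subseteq> T})) / real (card A)"
      using A by (simp add: measure_pmf_of_set)
    also have "A \<inter> {e. e \<in> T \<and> S \<subseteq> T} = (if S \<subseteq> T then T else {})" using T by auto
    finally show ?thesis by (simp add: indicator_def)
  qed
  then show ?case by (simp add: measure_bind_pmf_eq_expectation Suc.IH)
qed (simp add: measure_return)

lemma expectation_occupied_Suc:
  fixes h :: "'a set \<Rightarrow> real"
  assumes A: "finite A" "A \<noteq> {}"
  shows "measure_pmf.expectation (occupied A (Suc k)) h =
    measure_pmf.expectation (occupied A k) (\<lambda>S. (\<Sum>e\<in>A. h (insert e S)) / real (card A))"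
proof -
  let ?f = "\<lambda>S. map_pmf (\<lambda>e. insert e S) (pmf_of_set A)"
  have "measure_pmf.expectation (occupied A (Suc k)) h =
      (\<Sum>S\<in>set_pmf (occupied A k). pmf (occupied A k) S *\<^sub>R measure_pmf.expectation (?f S) h)"
    unfolding occupied.simps
    using A finite_set_occupied[OF A, of k] by (intro pmf_expectation_bind) (auto simp: set_pmf_of_set)
  also have "\<dots> = measure_pmf.expectation (occupied A k) (\<lambda>S. measure_pmf.expectation (?f S) h)"
    using finite_set_occupied[OF A, of k] by (subst integral_measure_pmf[of "set_pmf (occupied A k)"]) auto
  finally show ?thesis using A by (simp add: integral_pmf_of_set)
qed

lemma expectation_occupied_mono:
  fixes h :: "'a set \<Rightarrow> real"
  assumes A: "finite A" "A \<noteq> {}" and mono: "\<And>S T. S \<subseteq> T \<Longrightarrow> T \<subseteq> A \<Longrightarrow> h S \<le> h T"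
    and "k \<le> m"
  shows "measure_pmf.expectation (occupied A k) h \<le> measure_pmf.expectation (occupied A m) h"
  using \<open>k \<le> m\<close>
proof (induction m rule: dec_induct)
  case (step m)
  have "measure_pmf.expectation (occupied A m) h \<le> measure_pmf.expectation (occupied A (Suc m)) h"
    unfolding expectation_occupied_Suc[OF A]
  proof (rule expectation_pmf_mono[OF finite_set_occupied[OF A]])
    fix S assume "S \<in> set_pmf (occupied A m)"
    then have S: "S \<subseteq> A" using set_occupied[OF A] by blast
    have "real (card A) * h S = (\<Sum>e\<in>A. h S)" by simp
    also have "\<dots> \<le> (\<Sum>e\<in>A. h (insert e S))" using S by (intro sum_mono mono) auto
    finally show "h S \<le> (\<Sum>e\<in>A. h (insert e S)) / real (card A)"
      using A by (simp add: pos_le_divide_eq card_gt_0_iff mult.commute)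
  qed
  with step show ?case by simp
qed simp

text \<open>The Poisson generating function. It yields both the occupancy law and the Chernoff
  bounds.\<close>

lemma has_bochner_integral_poisson_power:
  assumes \<mu>: "\<mu> > 0" and z: "z \<ge> 0"
  shows "has_bochner_integral (measure_pmf (poisson_pmf \<mu>)) (\<lambda>k. z ^ k) (exp (\<mu> * (z - 1)))"
proof (rule has_bochner_integral_nn_integral)
  have "(\<lambda>k. (\<mu> * z) ^ k /\<^sub>R fact k) sums exp (\<mu> * z)" by (rule exp_converges)
  then have "(\<lambda>k. exp (- \<mu>) * ((\<mu> * z) ^ k /\<^sub>R fact k)) sums (exp (- \<mu>) * exp (\<mu> * z))"
    by (rule sums_mult)
  moreover have "exp (- \<mu>) * exp (\<mu> * z) = exp (\<mu> * (z - 1))"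
    by (simp add: exp_add[symmetric] algebra_simps)
  moreover have "exp (- \<mu>) * ((\<mu> * z) ^ k /\<^sub>R fact k) = pmf (poisson_pmf \<mu>) k * z ^ k" for k
    using \<mu> by (simp add: power_mult_distrib field_simps)
  ultimately have sums: "(\<lambda>k. pmf (poisson_pmf \<mu>) k * z ^ k) sums exp (\<mu> * (z - 1))" by simp
  have "(\<integral>\<^sup>+k. ennreal (z ^ k) \<partial>poisson_pmf \<mu>) = (\<integral>\<^sup>+k. ennreal (pmf (poisson_pmf \<mu>) k * z ^ k) \<partial>count_space UNIV)"
    using z by (simp add: nn_integral_measure_pmf ennreal_mult del: pmf_poisson)
  also have "\<dots> = (\<Sum>k. ennreal (pmf (poisson_pmf \<mu>) k * z ^ k))"
    by (rule nn_integral_count_space_nat)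
  also have "\<dots> = ennreal (exp (\<mu> * (z - 1)))"
    using sums z by (intro suminf_ennreal_eq) (auto simp del: pmf_poisson)
  finally show "(\<integral>\<^sup>+k. ennreal (z ^ k) \<partial>poisson_pmf \<mu>) = ennreal (exp (\<mu> * (z - 1)))" .
qed (use z in auto)

text \<open>Given \<open>k\<close> draws, all hits lie in \<open>T\<close> with probability
  \<open>(card T / card A) ^ k\<close>. The generating function at this ratio is
  \<open>exp (- \<mu> / card A)\<close> to the power \<open>card (A - T)\<close>, which is the
  containment probability of independent cells.\<close>

lemma poisson_occupied:
  assumes A: "finite A" "A \<noteq> {}" and \<mu>: "\<mu> > 0"
  shows "bind_pmf (poisson_pmf \<mu>) (occupied A) = random_subset A (1 - exp (- (\<mu> / real (card A))))"
proof (rule random_set_eqI[OF A(1) _ set_random_subset])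
  show "set_pmf (bind_pmf (poisson_pmf \<mu>) (occupied A)) \<subseteq> Pow A"
    using set_occupied[OF A] by auto
  fix T assume T: "T \<subseteq> A"
  have card: "real (card A) > 0" using A by (simp add: card_gt_0_iff)
  have "measure_pmf.prob (bind_pmf (poisson_pmf \<mu>) (occupied A)) {S. S \<subseteq> T} =
      measure_pmf.expectation (poisson_pmf \<mu>) (\<lambda>k. (real (card T) / real (card A)) ^ k)"
    by (simp add: measure_bind_pmf_eq_expectation prob_occupied_subset[OF A T])
  also have "\<dots> = exp (\<mu> * (real (card T) / real (card A) - 1))"
    by (intro has_bochner_integral_integral_eq has_bochner_integral_poisson_power \<mu>) simp
  also have "\<mu> * (real (card T) / real (card A) - 1) = real (card (A - T)) * (- (\<mu> / real (card A)))"
    using card card_mono[OF A(1) T] finite_subset[OF T A(1)] T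
    by (simp add: card_Diff_subset of_nat_diff field_simps)
  also have "exp \<dots> = (1 - (1 - exp (- (\<mu> / real (card A))))) ^ card (A - T)"
    by (subst exp_of_nat_mult) simp
  also have "\<dots> = measure_pmf.prob (random_subset A (1 - exp (- (\<mu> / real (card A))))) {S. S \<subseteq> T}"
    using A \<mu> by (subst prob_random_subset) auto
  finally show "measure_pmf.prob (bind_pmf (poisson_pmf \<mu>) (occupied A)) {S. S \<subseteq> T} =
      measure_pmf.prob (random_subset A (1 - exp (- (\<mu> / real (card A))))) {S. S \<subseteq> T}" .
qed

text \<open>De-Poissonisation: only Poisson counts in \<open>J\<close> are kept, and there the fixed
  count \<open>m\<close> gives a smaller expectation. For decreasing \<open>h\<close> one takes
  \<open>J = {..m}\<close>, for increasing \<open>h\<close> one takes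
  \<open>J = {m..}\<close>.\<close>

lemma prob_poisson_times_occupied_le:
  fixes h :: "'a set \<Rightarrow> real"
  assumes A: "finite A" "A \<noteq> {}" and \<mu>: "\<mu> > 0" and nonneg: "\<And>S. 0 \<le> h S"
    and le: "\<And>k. k \<in> J \<Longrightarrow> measure_pmf.expectation (occupied A m) h \<le> measure_pmf.expectation (occupied A k) h"
  shows "measure_pmf.prob (poisson_pmf \<mu>) J * measure_pmf.expectation (occupied A m) h
    \<le> measure_pmf.expectation (random_subset A (1 - exp (- (\<mu> / real (card A))))) h"
proof -
  note bind = expectation_bind_pmf_finite[of "Pow A" "occupied A" "poisson_pmf \<mu>" h]
  have fin: "finite (Pow A)" and sub: "\<And>k. set_pmf (occupied A k) \<subseteq> Pow A"
    using A set_occupied[OF A] by auto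
  have "measure_pmf.prob (poisson_pmf \<mu>) J * measure_pmf.expectation (occupied A m) h =
     measure_pmf.expectation (poisson_pmf \<mu>) (\<lambda>k. indicator J k * measure_pmf.expectation (occupied A m) h)"
    by simp
  also have "\<dots> \<le> measure_pmf.expectation (poisson_pmf \<mu>) (\<lambda>k. measure_pmf.expectation (occupied A k) h)"
  proof (rule integral_mono)
    show "integrable (poisson_pmf \<mu>) (\<lambda>k. indicator J k * measure_pmf.expectation (occupied A m) h)"
      by (intro integrable_mult_left measure_pmf.integrable_const_bound[of _ 1]) auto
    show "integrable (poisson_pmf \<mu>) (\<lambda>k. measure_pmf.expectation (occupied A k) h)"
      by (rule bind(2)[OF fin sub])
    show "indicator J k * measure_pmf.expectation (occupied A m) h \<le> measure_pmf.expectation (occupied A k) h" for k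
      using le[of k] nonneg by (auto simp: indicator_def intro!: integral_nonneg_AE)
  qed
  also have "\<dots> = measure_pmf.expectation (random_subset A (1 - exp (- (\<mu> / real (card A))))) h"
    using bind(1)[OF fin sub] poisson_occupied[OF A \<mu>] by simp
  finally show ?thesis .
qed

section \<open>Chernoff bounds for the Poisson distribution\<close>

lemma poisson_markov:
  assumes \<mu>: "\<mu> > 0" and z: "z > 0" and J: "\<And>k. k \<in> J \<Longrightarrow> 1 \<le> c * z ^ k" and c: "c \<ge> 0"
  shows "measure_pmf.prob (poisson_pmf \<mu>) J \<le> c * exp (\<mu> * (z - 1))"
proof -
  note hb = has_bochner_integral_poisson_power[OF \<mu>, of z]
  have int: "integrable (poisson_pmf \<mu>) (\<lambda>k. c * z ^ k)"
    using z by (intro integrable_mult_right integrable.intros[OF hb]) auto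
  have "measure_pmf.prob (poisson_pmf \<mu>) J = measure_pmf.expectation (poisson_pmf \<mu>) (indicator J)"
    by simp
  also have "\<dots> \<le> measure_pmf.expectation (poisson_pmf \<mu>) (\<lambda>k. c * z ^ k)"
  proof (rule integral_mono[OF _ int])
    show "integrable (poisson_pmf \<mu>) (indicator J :: nat \<Rightarrow> real)"
      by (rule measure_pmf.integrable_const_bound[of _ 1]) auto
    show "indicator J k \<le> c * z ^ k" for k
      using J[of k] c z by (auto simp: indicator_def)
  qed
  also have "\<dots> = c * exp (\<mu> * (z - 1))"
    using has_bochner_integral_integral_eq[OF hb] z by simp
  finally show ?thesis .
qed

lemma mult_exp_one_minus_less_1:
  fixes t :: real
  assumes "t > 0" "t \<noteq> 1"
  shows "t * exp (1 - t) < 1"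
proof -
  have "ln t < t - 1"
    using ln_le_minus_one[of t] ln_eq_minus_one[of t] assms by force
  then have "exp (ln t + (1 - t)) < exp 0" by (subst exp_less_cancel_iff) simp
  then show ?thesis using assms by (simp add: exp_add)
qed

lemma poisson_upper_tail:
  assumes t: "0 < t" "t < 1" and \<mu>: "0 < \<mu>" "\<mu> \<le> t * real m"
  shows "measure_pmf.prob (poisson_pmf \<mu>) {m..} \<le> (t * exp (1 - t)) ^ m"
proof -
  \<comment> \<open>The tilt \<open>z = 1 / t\<close> is optimal for mean \<open>t * m\<close>
    against threshold \<open>m\<close>; it exceeds 1 here and is below 1 for the lower tail, so both
    tails get the rate \<open>t * exp (1 - t)\<close>.\<close>
  have "measure_pmf.prob (poisson_pmf \<mu>) {m..} \<le> t ^ m * exp (\<mu> * (1 / t - 1))"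
  proof (rule poisson_markov)
    fix k assume "k \<in> {m..}"
    then have "t ^ k \<le> t ^ m" using t by (intro power_decreasing) auto
    then show "1 \<le> t ^ m * (1 / t) ^ k" using t by (simp add: power_divide field_simps)
  qed (use t \<mu> in auto)
  also have "\<dots> \<le> t ^ m * exp (t * real m * (1 / t - 1))"
    using t \<mu> by (intro mult_left_mono iffD2[OF exp_le_cancel_iff] mult_right_mono) auto
  also have "t * real m * (1 / t - 1) = real m * (1 - t)" using t by (simp add: field_simps)
  also have "t ^ m * exp (real m * (1 - t)) = (t * exp (1 - t)) ^ m"
    by (simp add: power_mult_distrib exp_of_nat_mult)
  finally show ?thesis .
qed

lemma poisson_lower_tail:
  assumes t: "1 < t" and m: "m > 0"
  shows "measure_pmf.prob (poisson_pmf (t * real m)) {..m} \<le> (t * exp (1 - t)) ^ m"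
proof -
  have "measure_pmf.prob (poisson_pmf (t * real m)) {..m} \<le> t ^ m * exp (t * real m * (1 / t - 1))"
  proof (rule poisson_markov)
    fix k assume "k \<in> {..m}"
    then have "t ^ k \<le> t ^ m" using t by (intro power_increasing) auto
    then show "1 \<le> t ^ m * (1 / t) ^ k" using t by (simp add: power_divide field_simps)
  qed (use t m in auto)
  also have "t * real m * (1 / t - 1) = real m * (1 - t)" using t by (simp add: field_simps)
  also have "t ^ m * exp (real m * (1 - t)) = (t * exp (1 - t)) ^ m"
    by (simp add: power_mult_distrib exp_of_nat_mult)
  finally show ?thesis .
qed

text \<open>The good event for a fine grid. For the occupied cells of \<open>m\<close> points,
  cardinality \<open>m\<close> says that no two draws hit the same cell, and the second part that no
  two cells share a coordinate; weak comparability of points then becomes strict comparability of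
  cells.\<close>

definition spread :: "nat \<Rightarrow> nat \<Rightarrow> (nat \<Rightarrow> nat) set \<Rightarrow> bool" where
  "spread d m S \<longleftrightarrow> card S = m \<and> (\<forall>e\<in>S. \<forall>f\<in>S. e \<noteq> f \<longrightarrow> (\<forall>i<d. e i \<noteq> f i))"

lemma card_edges_through_vertex:
  assumes "i < d"
  shows "n * card {e \<in> complete_edges d n. e i = v} \<le> n ^ d"
proof -
  let ?B = "\<lambda>j. if j = i then {v} else {1..n}"
  have "{e \<in> complete_edges d n. e i = v} \<subseteq> (\<Pi>\<^sub>E j\<in>{..<d}. ?B j)"
    by (auto simp: complete_edges_def PiE_def Pi_def extensional_def)
  then have "card {e \<in> complete_edges d n. e i = v} \<le> card (\<Pi>\<^sub>E j\<in>{..<d}. ?B j)"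
    by (intro card_mono finite_PiE) auto
  also have "\<dots> = (\<Prod>j<d. card (?B j))" by (simp add: card_PiE)
  also have "\<dots> = card (?B i) * (\<Prod>j\<in>{..<d} - {i}. card (?B j))"
    using assms by (subst prod.remove[of _ i]) auto
  also have "\<dots> = n ^ (d - 1)" using assms by simp
  finally have "n * card {e \<in> complete_edges d n. e i = v} \<le> n * n ^ (d - 1)" by simp
  also have "\<dots> = n ^ d" using assms by (cases d) auto
  finally show ?thesis .
qed

text \<open>A birthday bound. A new draw spoils a spread set of \<open>m\<close> cells only by
  agreeing with one of them in one of \<open>d\<close> coordinates, which has probability at most
  \<open>d * m / n\<close>; summing over the draws gives the quadratic bound.\<close>

lemma prob_not_spread:
  assumes d: "d > 0" and n: "n > 0"
  shows "measure_pmf.prob (occupied (complete_edges d n) m) {S. \<not> spread d m S} \<le> real d * (real m)\<^sup>2 / real n"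
proof (induction m)
  case 0
  then show ?case by (simp add: spread_def measure_return)
next
  case (Suc m)
  let ?A = "complete_edges d n" and ?O = "occupied (complete_edges d n)"
  let ?bad = "\<lambda>m. {S. \<not> spread d m S}"
  have A: "finite ?A" "?A \<noteq> {}" using complete_edges_nonempty[OF n] by auto
  have cA: "real (card ?A) = real n ^ d" "real n ^ d > 0" using n by (auto simp: card_complete_edges)
  \<comment> \<open>Conditional form of the birthday step: either \<open>S\<close> was bad before,
    or the next draw must share a coordinate with \<open>S\<close>.\<close>
  have step: "(\<Sum>e\<in>?A. indicator (?bad (Suc m)) (insert e S)) / real (card ?A)
      \<le> indicator (?bad m) S + real d * real m / real n" if S: "S \<subseteq> ?A" for S
  proof (cases "spread d m S")
    case False
    have "(\<Sum>e\<in>?A. indicator (?bad (Suc m)) (insert e S)) \<le> (\<Sum>e\<in>?A. 1::real)"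
      by (intro sum_mono) (auto simp: indicator_def)
    then have "(\<Sum>e\<in>?A. indicator (?bad (Suc m)) (insert e S)) / real (card ?A) \<le> 1"
      using cA by (simp add: divide_le_eq)
    moreover have "(1::real) \<le> indicator (?bad m) S + real d * real m / real n" using False by simp
    ultimately show ?thesis by linarith
  next
    case True
    then have fin: "card S = m" "finite S" using S finite_subset_complete_edges by (auto simp: spread_def)
    have "{e \<in> ?A. \<not> spread d (Suc m) (insert e S)} \<subseteq> (\<Union>f\<in>S. \<Union>i\<in>{..<d}. {e \<in> ?A. e i = f i})"
    proof safe
      fix e assume e: "e \<in> ?A" "\<not> spread d (Suc m) (insert e S)"
      show "e \<in> (\<Union>f\<in>S. \<Union>i\<in>{..<d}. {e \<in> ?A. e i = f i})"
      proof (rule ccontr)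
        assume *: "e \<notin> (\<Union>f\<in>S. \<Union>i\<in>{..<d}. {e \<in> ?A. e i = f i})"
        have ne: "e i \<noteq> f i" if "f \<in> S" "i < d" for f i using * that e by auto
        then have "e \<notin> S" using d by blast
        then have "card (insert e S) = Suc m" using fin by simp
        moreover have "\<forall>x\<in>insert e S. \<forall>y\<in>insert e S. x \<noteq> y \<longrightarrow> (\<forall>i<d. x i \<noteq> y i)"
          using True ne unfolding spread_def by (metis insert_iff)
        ultimately show False using e by (auto simp: spread_def)
      qed
    qed
    then have "card {e \<in> ?A. \<not> spread d (Suc m) (insert e S)}
        \<le> card (\<Union>f\<in>S. \<Union>i\<in>{..<d}. {e \<in> ?A. e i = f i})"
      using fin by (intro card_mono) auto
    also have "\<dots> \<le> (\<Sum>f\<in>S. card (\<Union>i\<in>{..<d}. {e \<in> ?A. e i = f i}))"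
      using fin by (intro card_UN_le) auto
    also have "\<dots> \<le> (\<Sum>f\<in>S. \<Sum>i<d. card {e \<in> ?A. e i = f i})"
      by (intro sum_mono card_UN_le) auto
    finally have "n * card {e \<in> ?A. \<not> spread d (Suc m) (insert e S)}
        \<le> (\<Sum>f\<in>S. \<Sum>i<d. n * card {e \<in> ?A. e i = f i})"
      by (simp add: sum_distrib_left[symmetric])
    also have "\<dots> \<le> (\<Sum>f\<in>S. \<Sum>i<d. n ^ d)"
      by (intro sum_mono card_edges_through_vertex) auto
    also have "\<dots> = m * d * n ^ d" using fin by simp
    finally have "real (n * card {e \<in> ?A. \<not> spread d (Suc m) (insert e S)}) \<le> real (m * d * n ^ d)"
      by (rule of_nat_mono)
    then have "real n * real (card {e \<in> ?A. \<not> spread d (Suc m) (insert e S)}) \<le> real m * real d * real n ^ d"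
      by (simp only: of_nat_mult of_nat_power)
    moreover have "(\<Sum>e\<in>?A. indicator (?bad (Suc m)) (insert e S)) = real (card {e \<in> ?A. \<not> spread d (Suc m) (insert e S)})"
      by (simp add: indicator_def sum.If_cases Int_def)
    ultimately have "(\<Sum>e\<in>?A. indicator (?bad (Suc m)) (insert e S)) / real (card ?A) \<le> real d * real m / real n"
      using n cA by (simp add: field_simps)
    then show ?thesis by (simp add: indicator_def)
  qed
  have "measure_pmf.prob (?O (Suc m)) (?bad (Suc m)) =
      measure_pmf.expectation (?O (Suc m)) (indicator (?bad (Suc m)))"
    by simp
  also have "\<dots> = measure_pmf.expectation (?O m)
      (\<lambda>S. (\<Sum>e\<in>?A. indicator (?bad (Suc m)) (insert e S)) / real (card ?A))"
    by (rule expectation_occupied_Suc[OF A])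
  also have "\<dots> \<le> measure_pmf.expectation (?O m) (\<lambda>S. indicator (?bad m) S + real d * real m / real n)"
    using set_occupied[OF A, of m] by (intro expectation_pmf_mono finite_set_occupied A step) blast
  also have "\<dots> = measure_pmf.prob (?O m) (?bad m) + real d * real m / real n"
    by (subst Bochner_Integration.integral_add)
      (auto intro!: integrable_measure_pmf_finite finite_set_occupied A)
  also have "\<dots> \<le> real d * (real m)\<^sup>2 / real n + real d * real m / real n" using Suc.IH by simp
  also have "\<dots> = real d * ((real m)\<^sup>2 + real m) / real n"
    by (simp add: distrib_left add_divide_distrib)
  also have "\<dots> \<le> real d * (real (Suc m))\<^sup>2 / real n"
    by (intro divide_right_mono mult_left_mono) (auto simp: power2_eq_square algebra_simps)
  finally show ?case .
qed

subsection \<open>Discretising uniform points\<close>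

text \<open>Index \<open>v\<close> stands for the interval from \<open>(v - 1) / n\<close>
  (excluded) to \<open>v / n\<close>. The measure space is the whole real line, so the index is
  clamped to \<open>{1..n}\<close>; in particular 0 falls into the first cell. Clamping preserves
  monotonicity.\<close>

definition grid_index :: "nat \<Rightarrow> real \<Rightarrow> nat" where
  "grid_index n x = max 1 (min n (nat \<lceil>real n * x\<rceil>))"

lemma grid_index_mono: "x \<le> y \<Longrightarrow> grid_index n x \<le> grid_index n y"
  unfolding grid_index_def
  by (intro max.mono min.mono nat_mono ceiling_mono mult_left_mono order_refl) auto

lemma grid_index_in: "n > 0 \<Longrightarrow> grid_index n x \<in> {1..n}"
  by (auto simp: grid_index_def)

lemma measurable_grid_index [measurable]: "grid_index n \<in> borel \<rightarrow>\<^sub>M count_space UNIV"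
  unfolding grid_index_def by measurable

abbreviation unif01 :: "real measure" where
  "unif01 \<equiv> uniform_measure lborel {0..1}"

lemma prob_space_unif01: "prob_space unif01"
  by (intro prob_space_uniform_measure) auto

lemma measure_grid_index:
  assumes n: "n > 0" and v: "v \<in> {1..n}"
  shows "measure unif01 {x. grid_index n x = v} = 1 / real n"
proof -
  have n': "real n > 0" using n by simp
  define a where "a = (real v - 1) / real n"
  define b where "b = real v / real n"
  have ab: "0 \<le> a" "a \<le> b" "b \<le> 1" "b - a = 1 / real n"
    using v n' by (auto simp: a_def b_def field_simps)
  \<comment> \<open>The first cell is closed on the left because the ceiling 0 at
    \<open>x = 0\<close> is raised to 1.\<close>
  have iff: "grid_index n x = v \<longleftrightarrow> x \<in> (if v = 1 then {0..b} else {a<..b})" if x: "0 \<le> x" "x \<le> 1" for x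
  proof -
    have "real n * x \<le> real n" using x n' by (simp add: mult_left_le)
    then have "\<lceil>real n * x\<rceil> \<le> int n" by (simp add: ceiling_le_iff)
    then have g: "grid_index n x = max 1 (nat \<lceil>real n * x\<rceil>)" by (simp add: grid_index_def)
    show ?thesis
    proof (cases "v = 1")
      case True
      have "grid_index n x = 1 \<longleftrightarrow> \<lceil>real n * x\<rceil> \<le> 1" unfolding g by linarith
      also have "\<dots> \<longleftrightarrow> real n * x \<le> 1" by (simp add: ceiling_le_iff)
      also have "\<dots> \<longleftrightarrow> x \<le> b" using n' True by (simp add: b_def field_simps)
      finally show ?thesis using True x by simp
    next
      case False
      then have "v \<ge> 2" using v by simp
      then have "grid_index n x = v \<longleftrightarrow> \<lceil>real n * x\<rceil> = int v" unfolding g by linarith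
      also have "\<dots> \<longleftrightarrow> real v - 1 < real n * x \<and> real n * x \<le> real v" by linarith
      also have "\<dots> \<longleftrightarrow> a < x \<and> x \<le> b" using n' by (auto simp: a_def b_def field_simps)
      finally show ?thesis using False by simp
    qed
  qed
  have "{0..1} \<inter> {x. grid_index n x = v} = (if v = 1 then {0..b} else {a<..b})"
    using iff ab by (auto split: if_splits) (smt (verit))+
  moreover have "measure lborel (if v = 1 then {0..b} else {a<..b}) = 1 / real n"
    using ab by (auto simp: b_def)
  moreover have "{x. grid_index n x = v} \<in> sets lborel" by measurable
  ultimately show ?thesis
    by (subst measure_uniform_measure) auto
qed

definition grid_cell :: "nat \<Rightarrow> nat \<Rightarrow> (nat \<Rightarrow> real) \<Rightarrow> nat \<Rightarrow> nat" where
  "grid_cell d n x = (\<lambda>i\<in>{..<d}. grid_index n (x i))"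

definition grid_cells :: "nat \<Rightarrow> nat \<Rightarrow> nat \<Rightarrow> (nat \<Rightarrow> nat \<Rightarrow> real) \<Rightarrow> (nat \<Rightarrow> nat) set" where
  "grid_cells d n m \<omega> = (\<lambda>j. grid_cell d n (\<omega> j)) ` {..<m}"

lemma grid_cell_in: "n > 0 \<Longrightarrow> grid_cell d n x \<in> complete_edges d n"
  using grid_index_in by (auto simp: grid_cell_def complete_edges_def)

lemma grid_cells_subset: "n > 0 \<Longrightarrow> grid_cells d n m \<omega> \<subseteq> complete_edges d n"
  by (auto simp: grid_cells_def grid_cell_in)

lemma prob_space_unif_cube: "prob_space (unif_cube d)"
  unfolding unif_cube_def by (intro prob_space_PiM prob_space_unif01)

lemma prob_space_unif_points: "prob_space (unif_points d m)"
  unfolding unif_points_def by (intro prob_space_PiM prob_space_unif_cube)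

lemma space_unif_cube: "space (unif_cube d) = extensional {..<d}"
  by (simp add: unif_cube_def space_PiM PiE_def)

lemma measurable_coord:
  assumes "j < m" "i < d"
  shows "(\<lambda>\<omega>. \<omega> j i) \<in> borel_measurable (unif_points d m)"
proof -
  have 1: "(\<lambda>\<omega>. \<omega> j) \<in> unif_points d m \<rightarrow>\<^sub>M unif_cube d"
    unfolding unif_points_def using assms by (intro measurable_component_singleton) auto
  have 2: "(\<lambda>x. x i) \<in> unif_cube d \<rightarrow>\<^sub>M unif01"
    unfolding unif_cube_def using assms by (intro measurable_component_singleton) auto
  have "(\<lambda>\<omega>. \<omega> j i) \<in> unif_points d m \<rightarrow>\<^sub>M unif01"
    using measurable_compose[OF 1 2] .
  then show ?thesis by (simp add: measurable_cong_sets[of _ _ unif01 borel])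
qed

lemma grid_cell_eq_iff:
  assumes "e \<in> complete_edges d n"
  shows "grid_cell d n x = e \<longleftrightarrow> (\<forall>i<d. grid_index n (x i) = e i)"
proof
  assume "\<forall>i<d. grid_index n (x i) = e i"
  then show "grid_cell d n x = e"
    using assms by (auto simp: grid_cell_def complete_edges_def PiE_def extensional_def fun_eq_iff)
qed (auto simp: grid_cell_def)

lemma measure_grid_cell:
  assumes n: "n > 0" and T: "T \<subseteq> complete_edges d n"
  shows "{x \<in> space (unif_cube d). grid_cell d n x \<in> T} \<in> sets (unif_cube d)" (is ?meas)
    and "measure (unif_cube d) {x \<in> space (unif_cube d). grid_cell d n x \<in> T} = real (card T) / real n ^ d" (is ?prob)
proof -
  interpret prob_space "unif_cube d" by (rule prob_space_unif_cube)
  interpret unif01: prob_space unif01 by (rule prob_space_unif01)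
  interpret P: finite_product_prob_space "\<lambda>_. unif01" "{..<d}" by unfold_locales simp
  have fib: "{x \<in> space (unif_cube d). grid_cell d n x = e} = (\<Pi>\<^sub>E i\<in>{..<d}. {x. grid_index n x = e i})"
    if "e \<in> complete_edges d n" for e
    using grid_cell_eq_iff[OF that] by (auto simp: space_unif_cube PiE_def)
  have meas1: "{x. grid_index n x = v} \<in> sets unif01" for v
    by simp
  have meas: "{x \<in> space (unif_cube d). grid_cell d n x = e} \<in> sets (unif_cube d)"
    if "e \<in> complete_edges d n" for e
    unfolding fib[OF that] unfolding unif_cube_def using meas1 by (intro sets_PiM_I_finite) auto
  have prob: "prob {x \<in> space (unif_cube d). grid_cell d n x = e} = 1 / real n ^ d"
    if "e \<in> complete_edges d n" for e
  proof -
    have "prob {x \<in> space (unif_cube d). grid_cell d n x = e} = (\<Prod>i<d. measure unif01 {x. grid_index n x = e i})"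
      unfolding fib[OF that] unfolding unif_cube_def by (rule P.prob_times) (rule meas1)
    also have "\<dots> = (\<Prod>i<d. 1 / real n)"
      using that by (intro prod.cong refl measure_grid_index n) (auto simp: complete_edges_def PiE_def Pi_def)
    finally show ?thesis by (simp add: power_divide)
  qed
  have finT: "finite T" using T finite_subset_complete_edges by blast
  have eq: "{x \<in> space (unif_cube d). grid_cell d n x \<in> T} =
      (\<Union>e\<in>T. {x \<in> space (unif_cube d). grid_cell d n x = e})" by auto
  show ?meas unfolding eq using meas T finT by (intro sets.finite_UN) auto
  have "prob {x \<in> space (unif_cube d). grid_cell d n x \<in> T} =
      (\<Sum>e\<in>T. prob {x \<in> space (unif_cube d). grid_cell d n x = e})"
    unfolding eq using meas T finT
    by (intro finite_measure_finite_Union) (auto simp: disjoint_family_on_def)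
  also have "\<dots> = (\<Sum>e\<in>T. 1 / real n ^ d)"
    using T by (intro sum.cong refl prob) auto
  finally show ?prob by simp
qed

lemma measure_grid_cells_subset:
  assumes n: "n > 0" and T: "T \<subseteq> complete_edges d n"
  shows "{\<omega> \<in> space (unif_points d m). grid_cells d n m \<omega> \<subseteq> T} \<in> sets (unif_points d m)" (is ?meas)
    and "measure (unif_points d m) {\<omega> \<in> space (unif_points d m). grid_cells d n m \<omega> \<subseteq> T}
      = (real (card T) / real n ^ d) ^ m" (is ?prob)
proof -
  interpret cube: prob_space "unif_cube d" by (rule prob_space_unif_cube)
  interpret P: finite_product_prob_space "\<lambda>_. unif_cube d" "{..<m}" by unfold_locales simp
  let ?X = "{x \<in> space (unif_cube d). grid_cell d n x \<in> T}"
  have eq: "{\<omega> \<in> space (unif_points d m). grid_cells d n m \<omega> \<subseteq> T} = (\<Pi>\<^sub>E j\<in>{..<m}. ?X)"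
    by (auto simp: unif_points_def space_PiM grid_cells_def PiE_def Pi_def)
  note X = measure_grid_cell[OF n T]
  show ?meas unfolding eq unfolding unif_points_def using X(1) by (intro sets_PiM_I_finite) auto
  have "measure (unif_points d m) (\<Pi>\<^sub>E j\<in>{..<m}. ?X) = (\<Prod>j<m. measure (unif_cube d) ?X)"
    unfolding unif_points_def by (rule P.prob_times) (rule X(1))
  then show ?prob unfolding eq X(2) by simp
qed

lemma grid_cells_eq_measurable:
  assumes n: "n > 0" and S: "S \<subseteq> complete_edges d n"
  shows "{\<omega> \<in> space (unif_points d m). grid_cells d n m \<omega> = S} \<in> sets (unif_points d m)"
proof -
  have fin: "finite (Pow S - {S})" using finite_subset_complete_edges[OF S] by simp
  have "{\<omega> \<in> space (unif_points d m). grid_cells d n m \<omega> = S} =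
    {\<omega> \<in> space (unif_points d m). grid_cells d n m \<omega> \<subseteq> S} -
    (\<Union>T\<in>Pow S - {S}. {\<omega> \<in> space (unif_points d m). grid_cells d n m \<omega> \<subseteq> T})"
    by auto
  also have "\<dots> \<in> sets (unif_points d m)"
    using S fin by (intro sets.Diff sets.finite_UN measure_grid_cells_subset(1)[OF n]) auto
  finally show ?thesis .
qed

text \<open>The cells hit by uniform points follow the occupancy law. Both sides have the same sums
  over \<open>Pow T\<close>, namely \<open>(card T / n ^ d) ^ m\<close>, and Moebius inversion gives
  single values.\<close>

lemma measure_grid_cells_eq:
  assumes n: "n > 0" and S: "S \<subseteq> complete_edges d n"
  shows "measure (unif_points d m) {\<omega> \<in> space (unif_points d m). grid_cells d n m \<omega> = S} =
    pmf (occupied (complete_edges d n) m) S"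
proof (rule eq_on_Pow_of_downset_sums[OF finite_complete_edges _ S,
      where g = "\<lambda>S. measure (unif_points d m) {\<omega> \<in> space (unif_points d m). grid_cells d n m \<omega> = S}"])
  interpret prob_space "unif_points d m" by (rule prob_space_unif_points)
  fix T assume T: "T \<subseteq> complete_edges d n"
  have fin: "finite T" using finite_subset_complete_edges[OF T] .
  have "(\<Sum>S\<in>Pow T. prob {\<omega> \<in> space (unif_points d m). grid_cells d n m \<omega> = S}) =
      prob (\<Union>S\<in>Pow T. {\<omega> \<in> space (unif_points d m). grid_cells d n m \<omega> = S})"
    using fin T by (intro finite_measure_finite_Union[symmetric])
      (auto simp: disjoint_family_on_def intro!: grid_cells_eq_measurable[OF n])
  also have "(\<Union>S\<in>Pow T. {\<omega> \<in> space (unif_points d m). grid_cells d n m \<omega> = S}) =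
      {\<omega> \<in> space (unif_points d m). grid_cells d n m \<omega> \<subseteq> T}" by auto
  also have "prob \<dots> = measure_pmf.prob (occupied (complete_edges d n) m) {S. S \<subseteq> T}"
    using complete_edges_nonempty[OF n] T
    by (simp add: measure_grid_cells_subset(2)[OF n T] prob_occupied_subset card_complete_edges)
  finally show "(\<Sum>S\<in>Pow T. prob {\<omega> \<in> space (unif_points d m). grid_cells d n m \<omega> = S}) =
      (\<Sum>S\<in>Pow T. pmf (occupied (complete_edges d n) m) S)"
    using prob_subset_eq_sum_pmf[OF fin] by simp
qed

text \<open>The integrand takes finitely many values, so it is a finite combination of indicators of
  measurable fibres. This supplies integrability together with the value.\<close>

lemma expectation_grid_cells:
  fixes f :: "(nat \<Rightarrow> nat) set \<Rightarrow> real"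
  assumes n: "n > 0"
  shows "has_bochner_integral (unif_points d m) (\<lambda>\<omega>. f (grid_cells d n m \<omega>))
    (measure_pmf.expectation (occupied (complete_edges d n) m) f)"
proof -
  let ?A = "complete_edges d n" and ?M = "unif_points d m"
  let ?E = "\<lambda>S. {\<omega> \<in> space ?M. grid_cells d n m \<omega> = S}"
  interpret prob_space ?M by (rule prob_space_unif_points)
  have A: "finite ?A" "?A \<noteq> {}" using complete_edges_nonempty[OF n] by auto
  have "has_bochner_integral ?M (\<lambda>\<omega>. f S * indicator (?E S) \<omega>) (f S * pmf (occupied ?A m) S)"
    if "S \<in> Pow ?A" for S
  proof (rule has_bochner_integral_mult_right)
    show "has_bochner_integral ?M (indicator (?E S)) (pmf (occupied ?A m) S)"
      using has_bochner_integral_real_indicator[of "?E S" ?M] that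
        grid_cells_eq_measurable[OF n, of S d m] measure_grid_cells_eq[OF n, of S d m]
      by (auto simp: emeasure_eq_measure)
  qed
  then have "has_bochner_integral ?M (\<lambda>\<omega>. \<Sum>S\<in>Pow ?A. f S * indicator (?E S) \<omega>)
      (\<Sum>S\<in>Pow ?A. f S * pmf (occupied ?A m) S)"
    by (rule has_bochner_integral_sum)
  moreover have "(\<Sum>S\<in>Pow ?A. f S * indicator (?E S) \<omega>) = f (grid_cells d n m \<omega>)" if "\<omega> \<in> space ?M" for \<omega>
  proof -
    have "(\<Sum>S\<in>Pow ?A. f S * indicator (?E S) \<omega>) =
       (\<Sum>S\<in>Pow ?A. if S = grid_cells d n m \<omega> then f S else 0)"
      using that by (intro sum.cong refl) (auto simp: indicator_def)
    also have "\<dots> = f (grid_cells d n m \<omega>)"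
      using A grid_cells_subset[OF n, of d m \<omega>] by (subst sum.delta) auto
    finally show ?thesis .
  qed
  moreover have "(\<Sum>S\<in>Pow ?A. f S * pmf (occupied ?A m) S) = measure_pmf.expectation (occupied ?A m) f"
    using A set_occupied[OF A, of m] by (intro integral_measure_pmf_real[symmetric]) auto
  ultimately show ?thesis by (simp cong: has_bochner_integral_cong)
qed

text \<open>Holds for every grid: strictly increasing cell indices force strictly increasing
  coordinates, as \<open>grid_index\<close> is monotone.\<close>

lemma max_noncrossing_grid_le:
  assumes "n > 0"
  shows "max_noncrossing d (grid_cells d n m \<omega>) \<le> longest_chain d (\<omega> ` {..<m})"
proof -
  have fin: "finite (grid_cells d n m \<omega>)" by (simp add: grid_cells_def)
  obtain M where M: "M \<subseteq> grid_cells d n m \<omega>" "strict_chain d M"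
    "card M = max_noncrossing d (grid_cells d n m \<omega>)"
    using max_noncrossing_witness[OF fin] by metis
  have "M \<subseteq> grid_cell d n ` (\<omega> ` {..<m})" using M(1) by (auto simp: grid_cells_def)
  moreover have "x i < y i" if "i < d" "grid_cell d n x i < grid_cell d n y i" for x y :: "nat \<Rightarrow> real" and i
    using that grid_index_mono[of "y i" "x i" n] by (auto simp: grid_cell_def not_less[symmetric])
  ultimately obtain N where "N \<subseteq> \<omega> ` {..<m}" "strict_chain d N" "card N = card M"
    using strict_chain_pullback[OF _ M(2)] by metis
  then show ?thesis
    using longest_chain_ge[of "\<omega> ` {..<m}" N d] strict_chain_imp_comp_chain M(3) by auto
qed

text \<open>The converse comparison needs \<open>spread\<close>: it makes the passage to cells
  injective on the chain and turns the weak inequalities between cell indices into strict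
  ones.\<close>

lemma longest_chain_le_grid:
  assumes spread: "spread d m (grid_cells d n m \<omega>)"
  shows "longest_chain d (\<omega> ` {..<m}) \<le> max_noncrossing d (grid_cells d n m \<omega>)"
proof -
  let ?g = "grid_cell d n"
  obtain C where C: "C \<subseteq> \<omega> ` {..<m}" "comp_chain d C" "card C = longest_chain d (\<omega> ` {..<m})"
    using longest_chain_witness[of "\<omega> ` {..<m}"] by blast
  have "inj_on (\<lambda>j. ?g (\<omega> j)) {..<m}"
    using spread by (intro eq_card_imp_inj_on) (auto simp: spread_def grid_cells_def)
  then have inj: "inj_on ?g C"
    using inj_on_imageI[of ?g \<omega> "{..<m}"] inj_on_subset[OF _ C(1), of ?g] by (simp add: comp_def)
  have "strict_chain d (?g ` C)"
    unfolding strict_chain_def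
  proof (intro ballI impI)
    fix e f assume ef: "e \<in> ?g ` C" "f \<in> ?g ` C" "e \<noteq> f"
    then obtain x y where xy: "x \<in> C" "y \<in> C" "e = ?g x" "f = ?g y" by auto
    have "e \<in> grid_cells d n m \<omega>" "f \<in> grid_cells d n m \<omega>"
      using xy C(1) by (auto simp: grid_cells_def)
    then have ne: "e i \<noteq> f i" if "i < d" for i
      using spread ef that by (auto simp: spread_def)
    have mono: "\<forall>i<d. ?g x i \<le> ?g y i" if "comp_le d x y" for x y
      using that grid_index_mono by (auto simp: comp_le_def grid_cell_def)
    have "comp_le d x y \<or> comp_le d y x" using C(2) xy by (auto simp: comp_chain_def)
    then show "(\<forall>i<d. e i < f i) \<or> (\<forall>i<d. f i < e i)"
      using mono[of x y] mono[of y x] ne xy by (metis order.strict_iff_order)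
  qed
  moreover have "?g ` C \<subseteq> grid_cells d n m \<omega>" using C(1) by (auto simp: grid_cells_def)
  ultimately have "card (?g ` C) \<le> max_noncrossing d (grid_cells d n m \<omega>)"
    by (intro max_noncrossing_ge) (auto simp: grid_cells_def)
  then show ?thesis using card_image[OF inj] C(3) by simp
qed

lemma longest_chain_le_card: "longest_chain d (\<omega> ` {..<m}) \<le> m"
proof -
  obtain C where C: "C \<subseteq> \<omega> ` {..<m}" "comp_chain d C" "card C = longest_chain d (\<omega> ` {..<m})"
    using longest_chain_witness[of "\<omega> ` {..<m}"] by blast
  have "card C \<le> card (\<omega> ` {..<m})" using C(1) by (intro card_mono) auto
  also have "\<dots> \<le> m" using card_image_le[of "{..<m}" \<omega>] by simp
  finally show ?thesis using C by simp
qed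

text \<open>Reduces measurability of the longest chain to finitely many comparisons of coordinates.
  Distinctness of points can be tested on the coordinates below \<open>d\<close> because points of
  the space are extensional.\<close>

lemma longest_chain_ge_iff:
  assumes "\<omega> \<in> space (unif_points d m)"
  shows "k \<le> longest_chain d (\<omega> ` {..<m}) \<longleftrightarrow>
    (\<exists>J\<in>{J. J \<subseteq> {..<m} \<and> card J = k}. \<forall>j\<in>J. \<forall>j'\<in>J.
       (j \<noteq> j' \<longrightarrow> (\<exists>i\<in>{..<d}. \<omega> j i \<noteq> \<omega> j' i)) \<and>
       ((\<forall>i\<in>{..<d}. \<omega> j i \<le> \<omega> j' i) \<or> (\<forall>i\<in>{..<d}. \<omega> j' i \<le> \<omega> j i)))"
    (is "_ \<longleftrightarrow> ?R")
proof
  assume k: "k \<le> longest_chain d (\<omega> ` {..<m})"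
  obtain C where C: "C \<subseteq> \<omega> ` {..<m}" "comp_chain d C" "card C = longest_chain d (\<omega> ` {..<m})"
    using longest_chain_witness[of "\<omega> ` {..<m}"] by blast
  obtain D where D: "D \<subseteq> C" "card D = k" using k C(3) obtain_subset_with_card_n by metis
  obtain J where J: "J \<subseteq> {..<m}" "inj_on \<omega> J" "D = \<omega> ` J"
    using subset_image_inj[of D \<omega> "{..<m}"] D(1) C(1) by auto
  have ext: "\<omega> j \<in> extensional {..<d}" if "j < m" for j
    using assms that by (auto simp: unif_points_def space_PiM space_unif_cube)
  have ne: "\<exists>i\<in>{..<d}. \<omega> j i \<noteq> \<omega> j' i" if "j \<in> J" "j' \<in> J" "j \<noteq> j'" for j j'
  proof (rule ccontr)
    assume "\<not> ?thesis"
    then have "\<omega> j = \<omega> j'"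
      using that J(1) by (intro extensionalityI[OF ext ext]) auto
    then show False using J(2) that by (auto simp: inj_on_def)
  qed
  have le: "(\<forall>i\<in>{..<d}. \<omega> j i \<le> \<omega> j' i) \<or> (\<forall>i\<in>{..<d}. \<omega> j' i \<le> \<omega> j i)" if "j \<in> J" "j' \<in> J" for j j'
  proof -
    have "\<omega> j \<in> C" "\<omega> j' \<in> C" using that D(1) J(3) by auto
    then show ?thesis using C(2) by (auto simp: comp_chain_def comp_le_def)
  qed
  have "card J = k" using D(2) J(2,3) by (simp add: card_image)
  then have "J \<in> {J. J \<subseteq> {..<m} \<and> card J = k}" using J(1) by simp
  then show ?R by (rule bexI[rotated]) (intro ballI conjI impI ne le)
next
  assume ?R
  then obtain J where J': "J \<in> {J. J \<subseteq> {..<m} \<and> card J = k}" "\<forall>j\<in>J. \<forall>j'\<in>J.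
       (j \<noteq> j' \<longrightarrow> (\<exists>i\<in>{..<d}. \<omega> j i \<noteq> \<omega> j' i)) \<and>
       ((\<forall>i\<in>{..<d}. \<omega> j i \<le> \<omega> j' i) \<or> (\<forall>i\<in>{..<d}. \<omega> j' i \<le> \<omega> j i))"
    by (rule bexE)
  then have J: "J \<subseteq> {..<m}" "card J = k"
    and ne: "\<And>j j'. j \<in> J \<Longrightarrow> j' \<in> J \<Longrightarrow> j \<noteq> j' \<Longrightarrow> \<exists>i\<in>{..<d}. \<omega> j i \<noteq> \<omega> j' i"
    and le: "\<And>j j'. j \<in> J \<Longrightarrow> j' \<in> J \<Longrightarrow> (\<forall>i\<in>{..<d}. \<omega> j i \<le> \<omega> j' i) \<or> (\<forall>i\<in>{..<d}. \<omega> j' i \<le> \<omega> j i)"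
    by simp_all
  have "inj_on \<omega> J" by (rule inj_onI) (metis ne)
  then have "card (\<omega> ` J) = k" using J by (simp add: card_image)
  moreover have "comp_chain d (\<omega> ` J)" using le by (force simp: comp_chain_def comp_le_def)
  ultimately show "k \<le> longest_chain d (\<omega> ` {..<m})"
    using longest_chain_ge[of "\<omega> ` {..<m}" "\<omega> ` J" d] J(1) by auto
qed

lemma measurable_longest_chain [measurable]:
  "(\<lambda>\<omega>. longest_chain d (\<omega> ` {..<m})) \<in> unif_points d m \<rightarrow>\<^sub>M count_space UNIV"
proof -
  let ?M = "unif_points d m"
  have fin: "finite {J. J \<subseteq> {..<m} \<and> card J = k}" for k by (rule finite_subset[of _ "Pow {..<m}"]) auto
  have ge: "{\<omega> \<in> space ?M. k \<le> longest_chain d (\<omega> ` {..<m})} \<in> sets ?M" for k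
  proof -
    have "{\<omega> \<in> space ?M. \<exists>J\<in>{J. J \<subseteq> {..<m} \<and> card J = k}. \<forall>j\<in>J. \<forall>j'\<in>J.
       (j \<noteq> j' \<longrightarrow> (\<exists>i\<in>{..<d}. \<omega> j i \<noteq> \<omega> j' i)) \<and>
       ((\<forall>i\<in>{..<d}. \<omega> j i \<le> \<omega> j' i) \<or> (\<forall>i\<in>{..<d}. \<omega> j' i \<le> \<omega> j i))} \<in> sets ?M"
    proof (intro sets.sets_Collect_finite_Ex[OF _ fin])
      fix J assume "J \<in> {J. J \<subseteq> {..<m} \<and> card J = k}"
      then have J: "J \<subseteq> {..<m}" by simp
      then have finJ: "finite J" using finite_subset by blast
      show "{\<omega> \<in> space ?M. \<forall>j\<in>J. \<forall>j'\<in>J.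
         (j \<noteq> j' \<longrightarrow> (\<exists>i\<in>{..<d}. \<omega> j i \<noteq> \<omega> j' i)) \<and>
         ((\<forall>i\<in>{..<d}. \<omega> j i \<le> \<omega> j' i) \<or> (\<forall>i\<in>{..<d}. \<omega> j' i \<le> \<omega> j i))} \<in> sets ?M"
      proof (intro sets.sets_Collect_finite_All[OF _ finJ])
        fix j j' assume "j \<in> J" "j' \<in> J"
        with J have jj: "j < m" "j' < m" by auto
        have c: "{\<omega> \<in> space ?M. \<omega> a i \<le> \<omega> b i} \<in> sets ?M" if "a < m" "b < m" "i < d" for a b i
          using that by (intro borel_measurable_le measurable_coord)
        have c': "{\<omega> \<in> space ?M. \<omega> a i \<noteq> \<omega> b i} \<in> sets ?M" if "a < m" "b < m" "i < d" for a b i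
          using that by (intro borel_measurable_neq measurable_coord)
        show "{\<omega> \<in> space ?M. (j \<noteq> j' \<longrightarrow> (\<exists>i\<in>{..<d}. \<omega> j i \<noteq> \<omega> j' i)) \<and>
         ((\<forall>i\<in>{..<d}. \<omega> j i \<le> \<omega> j' i) \<or> (\<forall>i\<in>{..<d}. \<omega> j' i \<le> \<omega> j i))} \<in> sets ?M"
          using jj by (intro sets.sets_Collect_conj sets.sets_Collect_disj sets.sets_Collect_imp
              sets.sets_Collect_const sets.sets_Collect_finite_All sets.sets_Collect_finite_Ex c c') auto
      qed
    qed
    then show ?thesis by (simp add: longest_chain_ge_iff cong: conj_cong)
  qed
  show ?thesis
  proof (rule measurable_count_space_eq2_countable[THEN iffD2], intro conjI ballI)
    fix k :: nat
    have "(\<lambda>\<omega>. longest_chain d (\<omega> ` {..<m})) -` {k} \<inter> space ?M =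
      {\<omega> \<in> space ?M. k \<le> longest_chain d (\<omega> ` {..<m})} - {\<omega> \<in> space ?M. Suc k \<le> longest_chain d (\<omega> ` {..<m})}"
      by auto
    also have "\<dots> \<in> sets ?M" by (intro sets.Diff ge)
    finally show "(\<lambda>\<omega>. longest_chain d (\<omega> ` {..<m})) -` {k} \<inter> space ?M \<in> sets ?M" .
  qed auto
qed

lemma prob_longest_chain_less:
  assumes n: "n > 0"
  shows "measure (unif_points d m) {\<omega> \<in> space (unif_points d m). real (longest_chain d (\<omega> ` {..<m})) < a}
    \<le> measure_pmf.prob (occupied (complete_edges d n) m) {S. real (max_noncrossing d S) < a}"
proof -
  let ?M = "unif_points d m" and ?f = "indicator {S. real (max_noncrossing d S) < a} :: _ \<Rightarrow> real"
  interpret prob_space ?M by (rule prob_space_unif_points)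
  note hb = expectation_grid_cells[OF n, of d m ?f]
  have "prob {\<omega> \<in> space ?M. real (longest_chain d (\<omega> ` {..<m})) < a} =
      expectation (indicator {\<omega> \<in> space ?M. real (longest_chain d (\<omega> ` {..<m})) < a})"
    by simp
  also have "\<dots> \<le> expectation (\<lambda>\<omega>. ?f (grid_cells d n m \<omega>))"
  proof (rule integral_mono[OF _ integrable.intros[OF hb]])
    show "integrable ?M (indicator {\<omega> \<in> space ?M. real (longest_chain d (\<omega> ` {..<m})) < a} :: _ \<Rightarrow> real)"
      by (intro integrable_real_indicator) (auto simp: emeasure_eq_measure)
    show "indicator {\<omega> \<in> space ?M. real (longest_chain d (\<omega> ` {..<m})) < a} \<omega> \<le> ?f (grid_cells d n m \<omega>)" for \<omega>
      using max_noncrossing_grid_le[OF n, of d m \<omega>] by (auto simp: indicator_def)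
  qed
  also have "\<dots> = measure_pmf.prob (occupied (complete_edges d n) m) {S. real (max_noncrossing d S) < a}"
    using has_bochner_integral_integral_eq[OF hb] by simp
  finally show ?thesis .
qed

lemma integrable_longest_chain:
  "integrable (unif_points d m) (\<lambda>\<omega>. real (longest_chain d (\<omega> ` {..<m})))"
proof -
  interpret prob_space "unif_points d m" by (rule prob_space_unif_points)
  have "(\<lambda>\<omega>. real (longest_chain d (\<omega> ` {..<m}))) \<in> borel_measurable (unif_points d m)"
    by measurable
  then show ?thesis
    by (intro integrable_const_bound[of _ "real m"]) (simp_all add: longest_chain_le_card)
qed

text \<open>Outside the spread event the chain is bounded by \<open>m\<close>. The resulting error
  vanishes for fixed \<open>m\<close> as the grid is refined.\<close>

lemma expectation_longest_chain_le:
  assumes d: "d > 0" and n: "n > 0"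
  shows "integral\<^sup>L (unif_points d m) (\<lambda>\<omega>. real (longest_chain d (\<omega> ` {..<m})))
    \<le> measure_pmf.expectation (occupied (complete_edges d n) m) (\<lambda>S. real (max_noncrossing d S))
      + real m * (real d * (real m)\<^sup>2 / real n)"
proof -
  let ?O = "occupied (complete_edges d n) m"
  let ?f = "\<lambda>S. real (max_noncrossing d S) + real m * indicator {S. \<not> spread d m S} S"
  note hb = expectation_grid_cells[OF n, of d m ?f]
  have fin: "finite (set_pmf ?O)" using complete_edges_nonempty[OF n] by (intro finite_set_occupied) auto
  have "integral\<^sup>L (unif_points d m) (\<lambda>\<omega>. real (longest_chain d (\<omega> ` {..<m})))
      \<le> integral\<^sup>L (unif_points d m) (\<lambda>\<omega>. ?f (grid_cells d n m \<omega>))"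
  proof (rule integral_mono[OF integrable_longest_chain integrable.intros[OF hb]])
    fix \<omega>
    show "real (longest_chain d (\<omega> ` {..<m})) \<le> ?f (grid_cells d n m \<omega>)"
      using longest_chain_le_grid[of d m n \<omega>] longest_chain_le_card[of d \<omega> m]
      by (cases "spread d m (grid_cells d n m \<omega>)") auto
  qed
  also have "\<dots> = measure_pmf.expectation ?O ?f" by (rule has_bochner_integral_integral_eq[OF hb])
  also have "\<dots> = measure_pmf.expectation ?O (\<lambda>S. real (max_noncrossing d S))
      + real m * measure_pmf.prob ?O {S. \<not> spread d m S}"
    by (subst Bochner_Integration.integral_add) (auto intro!: integrable_measure_pmf_finite fin)
  also have "\<dots> \<le> measure_pmf.expectation ?O (\<lambda>S. real (max_noncrossing d S))
      + real m * (real d * (real m)\<^sup>2 / real n)"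
    by (intro add_left_mono mult_left_mono prob_not_spread d n) auto
  finally show ?thesis .
qed

subsection \<open>Convergence in probability of the longest chain\<close>

text \<open>The event of a short chain becomes less likely with more points. The Poisson mean stays
  below \<open>m\<close> by the factor \<open>t\<close>, so except with exponentially small
  probability the \<open>m\<close> points are at least as many as the Poisson ones.\<close>

lemma prob_longest_chain_less_poisson:
  assumes d: "d > 0" and n: "n > 0" and x: "x > 0" and t: "0 < t" "t < 1"
    and xt: "x * real n ^ d \<le> t * real m"
  shows "measure (unif_points d m) {\<omega> \<in> space (unif_points d m). real (longest_chain d (\<omega> ` {..<m})) < a}
    \<le> measure_pmf.prob (rand_edges d n (1 - exp (- x))) {S. real (max_noncrossing d S) < a}
      + (t * exp (1 - t)) ^ m"
proof -
  let ?A = "complete_edges d n" and ?f = "indicator {S. real (max_noncrossing d S) < a} :: _ \<Rightarrow> real"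
  define \<mu> where "\<mu> = x * real n ^ d"
  have A: "finite ?A" "?A \<noteq> {}" using complete_edges_nonempty[OF n] by auto
  have \<mu>: "\<mu> > 0" "\<mu> / real (card ?A) = x" using x n by (auto simp: \<mu>_def card_complete_edges)
  have mono: "measure_pmf.expectation (occupied ?A m) ?f \<le> measure_pmf.expectation (occupied ?A k) ?f"
    if "k \<in> {..m}" for k
  proof -
    have "measure_pmf.expectation (occupied ?A k) (\<lambda>S. - ?f S) \<le> measure_pmf.expectation (occupied ?A m) (\<lambda>S. - ?f S)"
    proof (rule expectation_occupied_mono[OF A])
      fix S T assume "S \<subseteq> T" "T \<subseteq> ?A"
      then have "max_noncrossing d S \<le> max_noncrossing d T"
        by (intro max_noncrossing_mono finite_subset_complete_edges)
      then show "- ?f S \<le> - ?f T" by (auto simp: indicator_def)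
    qed (use that in simp)
    then show ?thesis by simp
  qed
  let ?q = "measure_pmf.prob (occupied ?A m) {S. real (max_noncrossing d S) < a}"
  let ?r = "measure_pmf.prob (poisson_pmf \<mu>) {m..}"
  have "measure_pmf.prob (poisson_pmf \<mu>) {..m} * measure_pmf.expectation (occupied ?A m) ?f
    \<le> measure_pmf.expectation (random_subset ?A (1 - exp (- (\<mu> / real (card ?A))))) ?f"
    by (rule prob_poisson_times_occupied_le[OF A \<mu>(1) _ mono]) auto
  then have "measure_pmf.prob (poisson_pmf \<mu>) {..m} * ?q
    \<le> measure_pmf.prob (rand_edges d n (1 - exp (- x))) {S. real (max_noncrossing d S) < a}"
    by (simp add: \<mu>(2))
  moreover have "1 - ?r \<le> measure_pmf.prob (poisson_pmf \<mu>) {..m}"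
  proof -
    have "1 - ?r = measure_pmf.prob (poisson_pmf \<mu>) (UNIV - {m..})"
      using measure_pmf.prob_compl[of "{m..}" "poisson_pmf \<mu>"] by simp
    also have "\<dots> \<le> measure_pmf.prob (poisson_pmf \<mu>) {..m}"
      by (intro measure_pmf.finite_measure_mono) auto
    finally show ?thesis .
  qed
  then have "(1 - ?r) * ?q \<le> measure_pmf.prob (poisson_pmf \<mu>) {..m} * ?q"
    by (intro mult_right_mono) auto
  moreover have "?r * ?q \<le> ?r * 1" by (intro mult_left_mono) auto
  moreover have "?r \<le> (t * exp (1 - t)) ^ m"
    by (rule poisson_upper_tail[OF t \<mu>(1)]) (use xt in \<open>simp add: \<mu>_def\<close>)
  ultimately have "?q \<le> measure_pmf.prob (rand_edges d n (1 - exp (- x))) {S. real (max_noncrossing d S) < a}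
      + (t * exp (1 - t)) ^ m"
    by (simp add: algebra_simps)
  with prob_longest_chain_less[OF n, of d m a] show ?thesis by linarith
qed

text \<open>Here the Poisson mean exceeds \<open>m\<close> by the factor \<open>t\<close>. With
  \<open>x = t * m / n ^ d\<close> the bound \<open>chain_const d * n * x powr (1/d)\<close> is
  independent of \<open>n\<close>, so \<open>n\<close> can tend to infinity and remove the collision
  error.\<close>

lemma expectation_longest_chain_le_chain_const:
  assumes d: "d > 0" and m: "m > 0" and t: "1 < t"
  shows "(1 - (t * exp (1 - t)) ^ m) *
      integral\<^sup>L (unif_points d m) (\<lambda>\<omega>. real (longest_chain d (\<omega> ` {..<m})))
    \<le> chain_const d * (t * real m) powr (1 / real d)" (is "(1 - ?\<rho>) * ?H \<le> ?c")
proof -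
  have "t * exp (1 - t) < 1" using t by (intro mult_exp_one_minus_less_1) auto
  then have \<rho>: "0 \<le> ?\<rho>" "?\<rho> \<le> 1" using t by (auto intro!: power_le_one)
  define K where "K = real m * (real d * (real m)\<^sup>2)"
  have bound: "(1 - ?\<rho>) * ?H \<le> ?c + K * inverse (real n)" if n: "n > 0" for n
  proof -
    let ?A = "complete_edges d n" and ?L = "\<lambda>S. real (max_noncrossing d S)"
    let ?O = "measure_pmf.expectation (occupied ?A m) ?L"
    define x where "x = t * real m / real n ^ d"
    have A: "finite ?A" "?A \<noteq> {}" using complete_edges_nonempty[OF n] by auto
    have x: "x > 0" "t * real m / real (card ?A) = x" using t m n by (auto simp: x_def card_complete_edges)
    have "measure_pmf.prob (poisson_pmf (t * real m)) {m..} * ?O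
      \<le> measure_pmf.expectation (random_subset ?A (1 - exp (- (t * real m / real (card ?A))))) ?L"
    proof (rule prob_poisson_times_occupied_le[OF A])
      fix k assume "k \<in> {m..}"
      then show "?O \<le> measure_pmf.expectation (occupied ?A k) ?L"
        by (intro expectation_occupied_mono[OF A] of_nat_mono max_noncrossing_mono
            finite_subset_complete_edges) auto
    qed (use t m in auto)
    also have "\<dots> = expected_L d (1 - exp (- x)) n" by (simp add: x(2) expected_L_eq)
    also have "\<dots> \<le> chain_const d * (real n * x powr (1 / real d))"
      by (rule expected_L_le_chain_const[OF d x(1)])
    also have "real n * x powr (1 / real d) = (t * real m) powr (1 / real d)"
    proof -
      have "x powr (1 / real d) = (t * real m) powr (1 / real d) / (real n ^ d) powr (1 / real d)"
        using t m by (simp add: x_def powr_divide)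
      also have "(real n ^ d) powr (1 / real d) = real n"
        using n d by (simp add: powr_realpow[symmetric] powr_powr)
      finally show ?thesis using n by simp
    qed
    finally have up: "measure_pmf.prob (poisson_pmf (t * real m)) {m..} * ?O \<le> ?c" .
    have "1 - ?\<rho> \<le> 1 - measure_pmf.prob (poisson_pmf (t * real m)) {..m}"
      using poisson_lower_tail[OF t m] by simp
    also have "\<dots> = measure_pmf.prob (poisson_pmf (t * real m)) (UNIV - {..m})"
      using measure_pmf.prob_compl[of "{..m}" "poisson_pmf (t * real m)"] by simp
    also have "\<dots> \<le> measure_pmf.prob (poisson_pmf (t * real m)) {m..}"
      by (intro measure_pmf.finite_measure_mono) auto
    finally have "(1 - ?\<rho>) * ?O \<le> measure_pmf.prob (poisson_pmf (t * real m)) {m..} * ?O"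
      by (intro mult_right_mono integral_nonneg_AE) auto
    with up have O: "(1 - ?\<rho>) * ?O \<le> ?c" by linarith
    have "(1 - ?\<rho>) * ?H \<le> (1 - ?\<rho>) * (?O + real m * (real d * (real m)\<^sup>2 / real n))"
      using \<rho> by (intro mult_left_mono expectation_longest_chain_le d n) auto
    also have "\<dots> = (1 - ?\<rho>) * ?O + (1 - ?\<rho>) * (K * inverse (real n))"
      by (simp add: K_def distrib_left divide_inverse mult.assoc)
    also have "\<dots> \<le> ?c + 1 * (K * inverse (real n))"
      using \<rho> O by (intro add_mono mult_right_mono) (auto simp: K_def)
    finally show ?thesis by simp
  qed
  have "(\<lambda>n. ?c + K * inverse (real n)) \<longlonglongrightarrow> ?c + K * 0"
    by (intro tendsto_intros lim_inverse_n)
  then have "(1 - ?\<rho>) * ?H \<le> ?c + K * 0"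
    by (rule LIMSEQ_le_const) (use bound in \<open>auto intro!: exI[of _ 1]\<close>)
  then show ?thesis by simp
qed

lemma filterlim_powr_at_top:
  assumes "s > 0"
  shows "filterlim (\<lambda>m. real m powr s) at_top sequentially"
  using assms by real_asymp

lemma lower_tail_longest_chain:
  assumes d: "d > 0" and \<eta>: "\<eta> > 0"
  shows "(\<lambda>m. measure (unif_points d m) {\<omega> \<in> space (unif_points d m).
      real (longest_chain d (\<omega> ` {..<m})) < (chain_const d - \<eta>) * real m powr (1 / real d)}) \<longlonglongrightarrow> 0"
    (is "(\<lambda>m. ?P m) \<longlonglongrightarrow> 0")
proof (cases "chain_const d \<le> \<eta>")
  case True
  have "?P m = 0" for m
  proof -
    have "(chain_const d - \<eta>) * real m powr (1 / real d) \<le> 0"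
      using True by (intro mult_nonpos_nonneg) auto
    then have "{\<omega> \<in> space (unif_points d m).
      real (longest_chain d (\<omega> ` {..<m})) < (chain_const d - \<eta>) * real m powr (1 / real d)} = {}"
      by auto
    then show ?thesis by (simp only: measure_empty)
  qed
  then show ?thesis by simp
next
  case False
  let ?r = "\<lambda>z. z powr (1 / real d)"
  define b where "b = chain_const d - \<eta>"
  define a where "a = chain_const d - \<eta> / 2"
  have ab: "0 < b" "b < a" "a < chain_const d" using False \<eta> by (auto simp: a_def b_def)
  obtain x n where xn: "x > 0" "n > 0" "a * (real n * ?r x) < expected_L d (1 - exp (- x)) n"
    using chain_const_approx[OF d ab(3)] .
  \<comment> \<open>The midpoint of \<open>b / a\<close> and 1, so that \<open>b < a * u\<close>.
    Thinning by \<open>t = u ^ d\<close> scales the chain length by exactly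
    \<open>u\<close>.\<close>
  define u where "u = (1 + b / a) / 2"
  define t where "t = u ^ d"
  have u: "0 < u" "u < 1" "b < a * u" using ab by (auto simp: u_def field_simps)
  have t: "0 < t" "t < 1" "?r t = u"
  proof -
    show "0 < t" "t < 1" using u d by (auto simp: t_def power_less_one_iff)
    show "?r t = u" using u d by (simp add: t_def powr_realpow[symmetric] powr_powr)
  qed
  define p where "p = 1 - exp (- x)"
  have p: "0 \<le> p" "p \<le> 1" using xn by (auto simp: p_def)
  \<comment> \<open>Ideal number of diagonal blocks of side \<open>n\<close>: it solves
    \<open>x * (s * n) ^ d = t * m\<close>. Rounding down to \<open>k m\<close> keeps the Poisson
    mean at most \<open>t * m\<close>.\<close>
  define s where "s m = ?r (t * real m / x) / real n" for m
  define k where "k m = nat \<lfloor>s m\<rfloor>" for m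
  have s_eq: "s m = u / (?r x * real n) * ?r (real m)" for m
    using t xn u by (simp add: s_def powr_divide powr_mult)
  have s_nonneg: "s m \<ge> 0" for m by (simp add: s_def)
  have k: "real (k m) \<le> s m" "s m - 1 \<le> real (k m)" for m
    using s_nonneg[of m] unfolding k_def by linarith+
  have s_lim: "filterlim s at_top sequentially"
    unfolding s_eq using u xn d by (intro filterlim_tendsto_pos_mult_at_top[OF tendsto_const] filterlim_powr_at_top) auto
  have k_lim: "filterlim k at_top sequentially"
    unfolding k_def[abs_def]
    by (rule filterlim_compose[OF filterlim_nat_sequentially
          filterlim_compose[OF filterlim_floor_sequentially s_lim]])
  have tail: "(\<lambda>m. measure_pmf.prob (rand_edges d (k m * n) p)
      {S. real (max_noncrossing d S) \<le> real (k m) * (a * (real n * ?r x))}) \<longlonglongrightarrow> 0"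
    using filterlim_compose[OF lower_tail_L[OF d p xn(2) xn(3)[folded p_def]] k_lim] .
  have "t * exp (1 - t) < 1" using t by (intro mult_exp_one_minus_less_1) auto
  then have pois: "(\<lambda>m. (t * exp (1 - t)) ^ m) \<longlonglongrightarrow> 0" using t by (intro LIMSEQ_realpow_zero) auto
  have "filterlim (\<lambda>m. (a * u - b) * ?r (real m)) at_top sequentially"
    using u d by (intro filterlim_tendsto_pos_mult_at_top[OF tendsto_const] filterlim_powr_at_top) auto
  \<comment> \<open>Rounding loses at most one block, worth \<open>a * n * x powr (1/d)\<close>; the
    gap between \<open>a * u\<close> and \<open>b\<close>, scaled by \<open>m powr (1/d)\<close>,
    eventually absorbs it.\<close>
  then have ev1: "\<forall>\<^sub>F m in sequentially. a * (real n * ?r x) \<le> (a * u - b) * ?r (real m)"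
    unfolding filterlim_at_top by blast
  have ev2: "\<forall>\<^sub>F m in sequentially. 1 \<le> k m"
    using k_lim unfolding filterlim_at_top by blast
  have bound: "\<forall>\<^sub>F m in sequentially. ?P m \<le> measure_pmf.prob (rand_edges d (k m * n) p)
      {S. real (max_noncrossing d S) \<le> real (k m) * (a * (real n * ?r x))} + (t * exp (1 - t)) ^ m"
    using ev1 ev2
  proof eventually_elim
    case (elim m)
    have kn: "k m * n > 0" using elim xn by simp
    have "real (k m * n) \<le> ?r (t * real m / x)"
      using k(1)[of m] xn by (simp add: s_def field_simps)
    then have "real (k m * n) ^ d \<le> ?r (t * real m / x) ^ d" by (intro power_mono) auto
    also have "\<dots> = t * real m / x"
    proof -
      have "m > 0"
      proof (rule ccontr)
        assume "\<not> m > 0"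
        then show False using elim k(1)[of m] by (simp add: s_def)
      qed
      then show ?thesis using t xn d by (simp add: powr_realpow[symmetric] powr_powr)
    qed
    finally have "x * real (k m * n) ^ d \<le> t * real m" using xn by (simp add: field_simps)
    from prob_longest_chain_less_poisson[OF d kn xn(1) t(1,2) this, of "b * ?r (real m)"]
    have "?P m \<le> measure_pmf.prob (rand_edges d (k m * n) p) {S. real (max_noncrossing d S) < b * ?r (real m)}
      + (t * exp (1 - t)) ^ m"
      by (simp add: b_def p_def)
    also have "\<dots> \<le> measure_pmf.prob (rand_edges d (k m * n) p)
      {S. real (max_noncrossing d S) \<le> real (k m) * (a * (real n * ?r x))} + (t * exp (1 - t)) ^ m"
    proof -
      have "s m * (a * (real n * ?r x)) = a * u * ?r (real m)"
        using xn by (simp add: s_eq)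
      then have "a * u * ?r (real m) - a * (real n * ?r x) = (s m - 1) * (a * (real n * ?r x))"
        by (simp only: left_diff_distrib mult_1)
      also have "\<dots> \<le> real (k m) * (a * (real n * ?r x))"
        using k(2)[of m] ab by (intro mult_right_mono) auto
      finally have "b * ?r (real m) \<le> real (k m) * (a * (real n * ?r x))"
        using elim(1) by (simp add: left_diff_distrib)
      then show ?thesis by (intro add_right_mono measure_pmf.finite_measure_mono) auto
    qed
    finally show ?case .
  qed
  have lim: "(\<lambda>m. measure_pmf.prob (rand_edges d (k m * n) p)
      {S. real (max_noncrossing d S) \<le> real (k m) * (a * (real n * ?r x))} + (t * exp (1 - t)) ^ m) \<longlonglongrightarrow> 0"
    using tendsto_add[OF tail pois] by simp
  show ?thesis
    by (rule tendsto_sandwich[OF always_eventually bound tendsto_const lim]) simp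
qed

lemma expectation_longest_chain_upper:
  assumes d: "d > 0" and y: "chain_const d < y"
  shows "\<forall>\<^sub>F m in sequentially.
    integral\<^sup>L (unif_points d m) (\<lambda>\<omega>. real (longest_chain d (\<omega> ` {..<m}))) \<le> y * real m powr (1 / real d)"
proof -
  let ?r = "\<lambda>z. z powr (1 / real d)" and ?c = "chain_const d"
  let ?H = "\<lambda>m. integral\<^sup>L (unif_points d m) (\<lambda>\<omega>. real (longest_chain d (\<omega> ` {..<m})))"
  have c: "?c \<ge> 0" by (rule chain_const_nonneg[OF d])
  \<comment> \<open>Some \<open>u > 1\<close> with \<open>chain_const d * u < y\<close>; the summand
    1 in the denominator guards against a vanishing constant.\<close>
  define u where "u = 1 + (y - ?c) / (2 * (?c + 1))"
  define t where "t = u ^ d"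
  have u: "1 < u" using y c by (simp add: u_def)
  have "?c * u < y"
  proof -
    have "?c / (2 * (?c + 1)) < 1" using c by (simp add: divide_less_eq)
    then have "(y - ?c) * (?c / (2 * (?c + 1))) < (y - ?c) * 1"
      using y by (intro mult_strict_left_mono) auto
    moreover have "?c * u = ?c + (y - ?c) * (?c / (2 * (?c + 1)))" by (simp add: u_def algebra_simps)
    ultimately show ?thesis by simp
  qed
  have t: "1 < t" "?r t = u"
    using u d by (auto simp: t_def one_less_power powr_realpow[symmetric] powr_powr)
  have "t * exp (1 - t) < 1" using t by (intro mult_exp_one_minus_less_1) auto
  then have "(\<lambda>m. (t * exp (1 - t)) ^ m) \<longlonglongrightarrow> 0" using t by (intro LIMSEQ_realpow_zero) auto
  then have "(\<lambda>m. y * (1 - (t * exp (1 - t)) ^ m)) \<longlonglongrightarrow> y * (1 - 0)"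
    by (intro tendsto_mult tendsto_diff tendsto_const)
  then have "\<forall>\<^sub>F m in sequentially. ?c * u < y * (1 - (t * exp (1 - t)) ^ m)"
    using \<open>?c * u < y\<close> by (intro order_tendstoD) auto
  then show ?thesis
    using eventually_gt_at_top[of 0]
  proof eventually_elim
    case (elim m)
    have pos: "0 < 1 - (t * exp (1 - t)) ^ m"
    proof -
      have "0 \<le> ?c * u" using c u by simp
      then have "0 < y * (1 - (t * exp (1 - t)) ^ m)" using elim by linarith
      then show ?thesis using y c by (simp add: zero_less_mult_iff)
    qed
    have "(1 - (t * exp (1 - t)) ^ m) * ?H m \<le> ?c * ?r (t * real m)"
      using elim by (intro expectation_longest_chain_le_chain_const d t)
    also have "\<dots> = ?c * u * ?r (real m)" using t by (simp add: powr_mult)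
    also have "\<dots> \<le> y * (1 - (t * exp (1 - t)) ^ m) * ?r (real m)"
      using elim by (intro mult_right_mono) auto
    finally have "(1 - (t * exp (1 - t)) ^ m) * ?H m \<le> (1 - (t * exp (1 - t)) ^ m) * (y * ?r (real m))"
      by (simp add: mult_ac)
    then show ?case using pos by simp
  qed
qed

text \<open>The lower tail together with the matching bound on the mean forces the upper tail to vanish,
  so no concentration inequality for the longest chain is needed.\<close>

lemma longest_chain_tendsto_in_probability:
  assumes d: "d > 0" and \<epsilon>: "\<epsilon> > 0"
  shows "(\<lambda>m. measure (unif_points d m) {\<omega> \<in> space (unif_points d m).
       \<bar>real (longest_chain d (\<omega> ` {..<m})) / real m powr (1 / real d) - chain_const d\<bar> > \<epsilon>}) \<longlonglongrightarrow> 0"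
proof -
  let ?r = "\<lambda>m. real m powr (1 / real d)" and ?c = "chain_const d"
  let ?M = "unif_points d"
  define X where "X m \<omega> = real (longest_chain d (\<omega> ` {..<m})) / ?r m" for m \<omega>
  define Lo where "Lo \<eta> m = measure (?M m) {\<omega> \<in> space (?M m). X m \<omega> < ?c - \<eta>}" for \<eta> m
  define Up where "Up m = measure (?M m) {\<omega> \<in> space (?M m). X m \<omega> > ?c + \<epsilon>}" for m
  have c: "?c \<ge> 0" by (rule chain_const_nonneg[OF d])
  have meas [measurable]: "X m \<in> borel_measurable (?M m)" for m
    unfolding X_def by measurable
  have Lo_lim: "Lo \<eta> \<longlonglongrightarrow> 0" if "\<eta> > 0" for \<eta>
  proof (rule Lim_transform_eventually[OF lower_tail_longest_chain[OF d that]])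
    show "\<forall>\<^sub>F m in sequentially. measure (?M m) {\<omega> \<in> space (?M m).
      real (longest_chain d (\<omega> ` {..<m})) < (?c - \<eta>) * ?r m} = Lo \<eta> m"
      using eventually_gt_at_top[of 0] by eventually_elim (simp add: Lo_def X_def divide_less_eq)
  qed
  have Up_le: "\<forall>\<^sub>F m in sequentially. \<epsilon> * Up m \<le> 2 * \<eta> + ?c * Lo \<eta> m" if \<eta>: "\<eta> > 0" for \<eta>
    using expectation_longest_chain_upper[OF d less_add_same_cancel1[THEN iffD2, OF \<eta>]] eventually_gt_at_top[of 0]
  proof eventually_elim
    case (elim m)
    interpret prob_space "?M m" by (rule prob_space_unif_points)
    let ?L = "{\<omega> \<in> space (?M m). X m \<omega> < ?c - \<eta>}" and ?U = "{\<omega> \<in> space (?M m). X m \<omega> > ?c + \<epsilon>}"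
    have rm: "?r m > 0" using elim by simp
    have intX: "integrable (?M m) (X m)" unfolding X_def by (intro integrable_divide integrable_longest_chain)
    have intL: "integrable (?M m) (indicator ?L :: _ \<Rightarrow> real)" "integrable (?M m) (indicator ?U :: _ \<Rightarrow> real)"
      by (intro integrable_real_indicator; simp add: emeasure_eq_measure)+
    \<comment> \<open>Compared pointwise: off both events \<open>X m\<close> is at least
      \<open>?c - \<eta>\<close>, on \<open>?U\<close> it gains \<open>\<epsilon>\<close>, and on
      \<open>?L\<close> the term \<open>?c\<close> compensates for the shortfall. Since the mean is
      at most \<open>?c + \<eta>\<close>, the event \<open>?U\<close> must be rare.\<close>
    have "?c - \<eta> + \<epsilon> * Up m = expectation (\<lambda>\<omega>. (?c - \<eta>) + \<epsilon> * indicator ?U \<omega>)"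
      using intL by (simp add: Up_def prob_space)
    also have "\<dots> \<le> expectation (\<lambda>\<omega>. X m \<omega> + ?c * indicator ?L \<omega>)"
    proof (rule integral_mono)
      show "integrable (?M m) (\<lambda>\<omega>. (?c - \<eta>) + \<epsilon> * indicator ?U \<omega>)" using intL by simp
      show "integrable (?M m) (\<lambda>\<omega>. X m \<omega> + ?c * indicator ?L \<omega>)" using intL intX by simp
      fix \<omega> assume "\<omega> \<in> space (?M m)"
      moreover have "X m \<omega> \<ge> 0" by (simp add: X_def)
      ultimately show "(?c - \<eta>) + \<epsilon> * indicator ?U \<omega> \<le> X m \<omega> + ?c * indicator ?L \<omega>"
        using c \<eta> \<epsilon> by (auto simp: indicator_def)
    qed
    also have "\<dots> = expectation (X m) + ?c * Lo \<eta> m"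
      using intL intX by (simp add: Lo_def)
    also have "expectation (X m) = expectation (\<lambda>\<omega>. real (longest_chain d (\<omega> ` {..<m}))) / ?r m"
      unfolding X_def by simp
    also have "\<dots> \<le> ?c + \<eta>"
      using elim \<eta> rm by (simp add: divide_le_eq)
    finally show ?case by simp
  qed
  have Up_lim: "Up \<longlonglongrightarrow> 0"
  proof (rule order_tendstoI)
    fix y :: real assume "0 < y"
    \<comment> \<open>Two of the four quarters pay for \<open>2 * \<eta>\<close>, the other two for
      the lower tail term.\<close>
    define \<eta> where "\<eta> = \<epsilon> * y / 4"
    have \<eta>: "\<eta> > 0" using \<open>0 < y\<close> \<epsilon> by (simp add: \<eta>_def)
    have "(\<lambda>m. ?c * Lo \<eta> m) \<longlonglongrightarrow> ?c * 0" by (intro tendsto_intros Lo_lim \<eta>)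
    then have "\<forall>\<^sub>F m in sequentially. ?c * Lo \<eta> m < 2 * \<eta>" using \<eta> by (intro order_tendstoD) auto
    with Up_le[OF \<eta>] show "\<forall>\<^sub>F m in sequentially. Up m < y"
    proof eventually_elim
      case (elim m)
      then have "\<epsilon> * Up m < \<epsilon> * y" by (simp add: \<eta>_def)
      then show ?case using \<epsilon> by simp
    qed
  next
    fix y :: real assume "y < 0"
    then show "\<forall>\<^sub>F m in sequentially. y < Up m"
      by (auto simp: Up_def intro!: always_eventually less_le_trans[OF _ measure_nonneg])
  qed
  have le: "measure (?M m) {\<omega> \<in> space (?M m). \<bar>X m \<omega> - ?c\<bar> > \<epsilon>} \<le> Lo \<epsilon> m + Up m" for m
  proof -
    interpret prob_space "?M m" by (rule prob_space_unif_points)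
    have "{\<omega> \<in> space (?M m). \<bar>X m \<omega> - ?c\<bar> > \<epsilon>} =
      {\<omega> \<in> space (?M m). X m \<omega> < ?c - \<epsilon>} \<union> {\<omega> \<in> space (?M m). X m \<omega> > ?c + \<epsilon>}"
      using \<epsilon> by (auto simp: abs_real_def split: if_splits)
    then show ?thesis unfolding Lo_def Up_def by (simp add: measure_Un_le)
  qed
  have lim: "(\<lambda>m. Lo \<epsilon> m + Up m) \<longlonglongrightarrow> 0"
    using tendsto_add[OF Lo_lim[OF \<epsilon>] Up_lim] by simp
  have "(\<lambda>m. measure (?M m) {\<omega> \<in> space (?M m). \<bar>X m \<omega> - ?c\<bar> > \<epsilon>}) \<longlonglongrightarrow> 0"
    by (rule tendsto_sandwich[OF always_eventually always_eventually tendsto_const lim]) (simp, intro allI le)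
  then show ?thesis by (simp add: X_def)
qed

lemma ulam_const_eq_chain_const:
  assumes d: "d > 0"
  shows "ulam_const d = chain_const d"
  unfolding ulam_const_def
proof (rule the_equality)
  show "\<forall>\<epsilon>>0. (\<lambda>m. measure (unif_points d m) {\<omega> \<in> space (unif_points d m).
       \<bar>real (longest_chain d (\<omega> ` {..<m})) / real m powr (1 / real d) - chain_const d\<bar> > \<epsilon>}) \<longlonglongrightarrow> 0"
    using longest_chain_tendsto_in_probability[OF d] by blast
  fix c
  assume c: "\<forall>\<epsilon>>0. (\<lambda>m. measure (unif_points d m) {\<omega> \<in> space (unif_points d m).
       \<bar>real (longest_chain d (\<omega> ` {..<m})) / real m powr (1 / real d) - c\<bar> > \<epsilon>}) \<longlonglongrightarrow> 0"
  show "c = chain_const d"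
  proof (rule ccontr)
    assume ne: "c \<noteq> chain_const d"
    \<comment> \<open>Intervals of radius one third of the distance are disjoint, so the two
      deviation events cover the space and their probabilities cannot both tend to 0.\<close>
    define \<epsilon> where "\<epsilon> = \<bar>c - chain_const d\<bar> / 3"
    have \<epsilon>: "\<epsilon> > 0" using ne by (simp add: \<epsilon>_def)
    define X where "X m \<omega> = real (longest_chain d (\<omega> ` {..<m})) / real m powr (1 / real d)" for m \<omega>
    have meas [measurable]: "X m \<in> borel_measurable (unif_points d m)" for m
      unfolding X_def by measurable
    define E where "E a m = {\<omega> \<in> space (unif_points d m). \<bar>X m \<omega> - a\<bar> > \<epsilon>}" for a m
    have "1 \<le> measure (unif_points d m) (E c m) + measure (unif_points d m) (E (chain_const d) m)" for m
    proof -
      interpret prob_space "unif_points d m" by (rule prob_space_unif_points)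
      have sets: "E a m \<in> events" for a unfolding E_def by measurable
      have "\<bar>X m \<omega> - c\<bar> > \<epsilon> \<or> \<bar>X m \<omega> - chain_const d\<bar> > \<epsilon>" for \<omega>
      proof (rule disjCI)
        have "3 * \<epsilon> \<le> \<bar>X m \<omega> - c\<bar> + \<bar>X m \<omega> - chain_const d\<bar>"
          using abs_triangle_ineq4[of "X m \<omega> - chain_const d" "X m \<omega> - c"] by (simp add: \<epsilon>_def)
        moreover assume "\<not> \<bar>X m \<omega> - chain_const d\<bar> > \<epsilon>"
        ultimately show "\<bar>X m \<omega> - c\<bar> > \<epsilon>" using \<epsilon> by linarith
      qed
      then have "E c m \<union> E (chain_const d) m = space (unif_points d m)" by (auto simp: E_def)
      then show ?thesis using measure_Un_le[OF sets[of c] sets[of "chain_const d"]] prob_space by simp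
    qed
    moreover have "(\<lambda>m. measure (unif_points d m) (E c m) + measure (unif_points d m) (E (chain_const d) m))
        \<longlonglongrightarrow> 0 + 0"
      using c longest_chain_tendsto_in_probability[OF d \<epsilon>] \<epsilon>
      unfolding E_def X_def by (intro tendsto_add) auto
    ultimately have "1 \<le> (0 + 0 :: real)"
      by (intro LIMSEQ_le_const) auto
    then show False by simp
  qed
qed

theorem theorem2:
  fixes d :: nat
  assumes "d > 0"
  shows "\<exists>\<delta> :: real \<Rightarrow> real.
    (\<forall>p. 0 < p \<and> p < 1 \<longrightarrow>
       (\<lambda>n. expected_L d p n / real n) \<longlonglongrightarrow> \<delta> p \<and>
       (SUP n\<in>{1..}. expected_L d p n / real n) = \<delta> p) \<and>
    ((\<lambda>p. \<delta> p / p powr (1 / real d)) \<longlongrightarrow> ulam_const d) (at_right 0)"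
\<comment> \<open>The witness stays schematic and is fixed as the supremum by the first
  \<open>show\<close>; the equation with the supremum then closes by reflexivity.\<close>
proof (intro exI conjI allI impI)
  fix p :: real assume "0 < p \<and> p < 1"
  then show "(\<lambda>n. expected_L d p n / real n) \<longlonglongrightarrow> (SUP n\<in>{1..}. expected_L d p n / real n)"
    by (intro expected_L_tendsto_SUP assms) auto
next
  show "((\<lambda>p. (SUP n\<in>{1..}. expected_L d p n / real n) / p powr (1 / real d)) \<longlongrightarrow> ulam_const d) (at_right 0)"
    unfolding ulam_const_eq_chain_const[OF assms] by (rule SUP_expected_L_asymp[OF assms])
qed (rule refl)

end
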